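(* Let $G,H_1,H_2$ be graphs with $m_2(H_1) \geq m_2(H_2)>1$, $m(G) \leq m_2(H_1,H_2)$ and $(H_1, H_2)$ a heart. Then $G \not\to (H_1,H_2)$ if any of the following conditions is satisfied: (i) $m_2(H_1)=m_2(H_2)$; (ii) $\chi(H_2) \geq 3$; (iii) $m(H_2) >2$; (iv) $ar(H_2)>2$; (v) $H_1=K_a$ for some $a \geq 3$; (vi) $H_1=K_{a,b}$ for some $a,b \geq 2$; (vii) there exists $\ell \in \mathbb{N}$ such that $\ell<ar(H_1)$ and $m_2(H_1,H_2) \leq \ell+\frac{1}{2}$; (viii) there exists $\ell \in \mathbb{N}$ such that $\ell<m(H_1)$ and $m_2(H_1,H_2) \leq \ell+1$, and $H_2$ is not a cycle.
   Context: All graphs are finite; a graph is non-empty if it has at least one edge; $v(H),e(H)$ are the numbers of vertices and edges; $J \subseteq H$ means $J$ is a (not necessarily induced) subgraph of $H$. $G \to (H_1,H_2)$ means: every colouring of the edges of $G$ with colours $1,2$ yields a copy of $H_1$ with all edges of colour $1$ or a copy of $H_2$ with all edges of colour $2$; $G\not\to(H_1,H_2)$ is the negation. Densities: $d(H)=e(H)/v(H)$ if $v(H)\ge 1$ and $0$ otherwise; $m(H)=\max\{d(J):J\subseteq H\}$. $d_1(H)=e(H)/(v(H)-1)$ if $v(H)\geq 2$ and $0$ otherwise; $ar(H)=\max\{d_1(J):J\subseteq H\}$ (arboricity). $d_2(H)=(e(H)-1)/(v(H)-2)$ if $H$ is non-empty with $v(H)\geq 3$, $d_2(H)=1/2$ if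 $H\cong K_2$, and $d_2(H)=0$ otherwise; $m_2(H)=\max\{d_2(J):J\subseteq H\}$. $H$ is strictly $2$-balanced if $d_2(J)<m_2(H)$ for all proper subgraphs $J\subsetneq H$. For graphs with $m_2(H_1)\geq m_2(H_2)$: $d_2(H_1,H_2)=\frac{e(H_1)}{v(H_1)-2+1/m_2(H_2)}$ if $H_2$ is non-empty and $v(H_1)\geq 2$, and $0$ otherwise (the same formula defines $d_2(J,H_2)$ for $J\subseteq H_1$); $m_2(H_1,H_2)=\max\{d_2(J,H_2):J\subseteq H_1\}$. $H_1$ is strictly balanced with respect to $d_2(\cdot,H_2)$ if $d_2(J,H_2)<m_2(H_1,H_2)$ for all proper subgraphs $J\subsetneq H_1$. Heart: a pair $(H_1,H_2)$ with $m_2(H_1)\geq m_2(H_2)$ is a heart if $H_2$ is strictly $2$-balanced; $H_1$ is strictly $2$-balanced when $m_2(H_1)=m_2(H_2)$; and $H_1$ is strictly balanced with respect to $d_2(\cdot,H_2)$ when $m_2(H_1)>m_2(H_2)$. $\chi$ is the chromatic number; $K_a$, $K_{a,b}$ are the complete and complete bipartite graphs. *)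

theory Defs
  imports Complex_Main
begin

type_synonym 'a ugraph = "'a set \<times> 'a set set"

abbreviation verts :: "'a ugraph \<Rightarrow> 'a set" where
  "verts G \<equiv> fst G"

abbreviation edges :: "'a ugraph \<Rightarrow> 'a set set" where
  "edges G \<equiv> snd G"

text \<open>Finite simple graphs; the graph without vertices is allowed.\<close>

definition fin_graph :: "'a ugraph \<Rightarrow> bool" where
  "fin_graph G \<longleftrightarrow> finite (verts G) \<and> (\<forall>e\<in>edges G. e \<subseteq> verts G \<and> card e = 2)"

definition nonempty_graph :: "'a ugraph \<Rightarrow> bool" where
  "nonempty_graph G \<longleftrightarrow> edges G \<noteq> {}"

definition vn :: "'a ugraph \<Rightarrow> nat" where
  "vn G = card (verts G)"

definition en :: "'a ugraph \<Rightarrow> nat" where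
  "en G = card (edges G)"

definition subgraph :: "'a ugraph \<Rightarrow> 'a ugraph \<Rightarrow> bool" where
  "subgraph J H \<longleftrightarrow> fin_graph J \<and> verts J \<subseteq> verts H \<and> edges J \<subseteq> edges H"

definition proper_subgraph :: "'a ugraph \<Rightarrow> 'a ugraph \<Rightarrow> bool" where
  "proper_subgraph J H \<longleftrightarrow> subgraph J H \<and> J \<noteq> H"

definition isomorphic :: "'a ugraph \<Rightarrow> 'b ugraph \<Rightarrow> bool" where
  "isomorphic G H \<longleftrightarrow>
     (\<exists>f. bij_betw f (verts G) (verts H) \<and> edges H = (\<lambda>e. f ` e) ` edges G)"

definition complete_graph :: "nat \<Rightarrow> nat ugraph" where
  "complete_graph n = ({..<n}, {{i, j} | i j. i < n \<and> j < n \<and> i \<noteq> j})"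

definition complete_bipartite_graph :: "nat \<Rightarrow> nat \<Rightarrow> (nat + nat) ugraph" where
  "complete_bipartite_graph a b =
     ({..<a} <+> {..<b}, {{Inl i, Inr j} | i j. i < a \<and> j < b})"

definition cycle_graph :: "nat \<Rightarrow> nat ugraph" where
  "cycle_graph n = ({..<n}, {{i, (i + 1) mod n} | i. i < n})"

definition is_cycle :: "'a ugraph \<Rightarrow> bool" where
  "is_cycle H \<longleftrightarrow> (\<exists>n\<ge>3. isomorphic H (cycle_graph n))"

definition colourable :: "'a ugraph \<Rightarrow> nat \<Rightarrow> bool" where
  "colourable G k \<longleftrightarrow>
     (\<exists>f::'a \<Rightarrow> nat. (\<forall>v\<in>verts G. f v < k) \<and> (\<forall>u v. {u, v} \<in> edges G \<longrightarrow> f u \<noteq> f v))"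

definition chromatic_number :: "'a ugraph \<Rightarrow> nat" where
  "chromatic_number G = (LEAST k. colourable G k)"

definition mono_copy ::
    "'a ugraph \<Rightarrow> ('a set \<Rightarrow> nat) \<Rightarrow> nat \<Rightarrow> 'b ugraph \<Rightarrow> bool" where
  "mono_copy G c i H \<longleftrightarrow>
     (\<exists>J. subgraph J G \<and> isomorphic J H \<and> (\<forall>e\<in>edges J. c e = i))"

definition arrows :: "'a ugraph \<Rightarrow> 'b ugraph \<Rightarrow> 'c ugraph \<Rightarrow> bool" where
  "arrows G H1 H2 \<longleftrightarrow>
     (\<forall>c. (\<forall>e\<in>edges G. c e \<in> {1, 2}) \<longrightarrow> mono_copy G c 1 H1 \<or> mono_copy G c 2 H2)"

text \<open>The maxima below range over a finite non-empty set, so that \<^const>\<open>Max\<close> is meaningful.\<close>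

lemma finite_subgraphs:
  assumes "fin_graph H"
  shows "finite {J. subgraph J H}" and "{J. subgraph J H} \<noteq> {}"
proof -
  have "edges H \<subseteq> Pow (verts H)"
    using assms by (auto simp: fin_graph_def)
  then have "finite (Pow (verts H) \<times> Pow (edges H))"
    using assms by (simp add: fin_graph_def finite_subset)
  moreover have "{J. subgraph J H} \<subseteq> Pow (verts H) \<times> Pow (edges H)"
    by (auto simp: subgraph_def)
  ultimately show "finite {J. subgraph J H}"
    by (rule rev_finite_subset)
  have "subgraph H H"
    using assms by (simp add: subgraph_def)
  then show "{J. subgraph J H} \<noteq> {}"
    by blast
qed

definition d_dens :: "'a ugraph \<Rightarrow> real" where
  "d_dens H = (if vn H \<ge> 1 then real (en H) / real (vn H) else 0)"

definition m_dens :: "'a ugraph \<Rightarrow> real" where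
  "m_dens H = Max (d_dens ` {J. subgraph J H})"

definition d1_dens :: "'a ugraph \<Rightarrow> real" where
  "d1_dens H = (if vn H \<ge> 2 then real (en H) / (real (vn H) - 1) else 0)"

text \<open>The fractional version of arboricity: no rounding up.\<close>

definition ar :: "'a ugraph \<Rightarrow> real" where
  "ar H = Max (d1_dens ` {J. subgraph J H})"

definition d2_dens :: "'a ugraph \<Rightarrow> real" where
  "d2_dens H =
     (if nonempty_graph H \<and> vn H \<ge> 3 then (real (en H) - 1) / (real (vn H) - 2)
      else if isomorphic H (complete_graph 2) then 1 / 2
      else 0)"

definition m2_dens :: "'a ugraph \<Rightarrow> real" where
  "m2_dens H = Max (d2_dens ` {J. subgraph J H})"

definition strictly_2_balanced :: "'a ugraph \<Rightarrow> bool" where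
  "strictly_2_balanced H \<longleftrightarrow> (\<forall>J. proper_subgraph J H \<longrightarrow> d2_dens J < m2_dens H)"

text \<open>The asymmetric densities are only of interest if \<^term>\<open>m2_dens H1 \<ge> m2_dens H2\<close>.\<close>

definition d2_asym :: "'a ugraph \<Rightarrow> 'b ugraph \<Rightarrow> real" where
  "d2_asym H1 H2 =
     (if nonempty_graph H2 \<and> vn H1 \<ge> 2
      then real (en H1) / (real (vn H1) - 2 + 1 / m2_dens H2)
      else 0)"

definition m2_asym :: "'a ugraph \<Rightarrow> 'b ugraph \<Rightarrow> real" where
  "m2_asym H1 H2 = Max ((\<lambda>J. d2_asym J H2) ` {J. subgraph J H1})"

definition strictly_balanced_wrt :: "'a ugraph \<Rightarrow> 'b ugraph \<Rightarrow> bool" where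
  "strictly_balanced_wrt H1 H2 \<longleftrightarrow>
     (\<forall>J. proper_subgraph J H1 \<longrightarrow> d2_asym J H2 < m2_asym H1 H2)"

definition heart :: "'a ugraph \<Rightarrow> 'b ugraph \<Rightarrow> bool" where
  "heart H1 H2 \<longleftrightarrow>
     m2_dens H1 \<ge> m2_dens H2 \<and>
     strictly_2_balanced H2 \<and>
     (m2_dens H1 = m2_dens H2 \<longrightarrow> strictly_2_balanced H1) \<and>
     (m2_dens H1 > m2_dens H2 \<longrightarrow> strictly_balanced_wrt H1 H2)"

end

theory Submission
  imports Defs
begin

text \<open>
  Write \<open>m\<close> for the asymmetric density; every vertex set of \<open>G\<close> spans at most \<open>m\<close> times as many edges
  as it has vertices. Call an edge set \<open>(k, t)\<close>-sparse if every set \<open>S\<close> of at least two vertices spans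
  at most \<open>k |S| - t\<close> of its edges; for \<open>t = k\<close> this is a union of \<open>k\<close> forests, for \<open>t = 0\<close> a union of
  \<open>k\<close> pseudoforests. Sparse sets form a matroid, so matroid union reduces a splitting of \<open>G\<close> into a
  \<open>(k\<^sub>1, t\<^sub>1)\<close>-sparse and a \<open>(k\<^sub>2, t\<^sub>2)\<close>-sparse colour class to counting edges. Cases (iii), (iv), (vii)
  and (viii) follow with forests and pseudoforests. For \<open>K\<^sub>a\<^sub>,\<^sub>b\<close> one uses a forest and an \<open>(L, t)\<close>-sparse
  class, where \<open>L = \<lfloor>m\<rfloor>\<close> and \<open>t\<close> is the least number for which a graph with the parameters of
  \<open>H\<^sub>1\<close> is not \<open>(L, t)\<close>-sparse. Cases (ii) and (v) partition the vertices of \<open>G\<close>, which is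
  \<open>\<lfloor>2 m\<rfloor>\<close>-degenerate, and colour an edge by whether it joins two classes. Case (i) combines these
  arguments according to whether \<open>H\<^sub>2\<close> is bipartite; for two triangles one five-colours the vertices and
  splits \<open>K\<^sub>5\<close> into two five-cycles.
\<close>

section \<open>Sparse edge sets and matroid union\<close>

text \<open>For unequal densities, the balancedness of \<open>H1\<close> enters only through a few
  inequalities: with \<open>m\<close> as above, \<open>m > m2(H2)\<close>,
  \<open>e(H1) - 1 > m * (v(H1) - 2)\<close>, \<open>2 * m < v(H1) + 1\<close>, and every degree of
  \<open>H1\<close> exceeds \<open>m\<close>. For equal densities the second one becomes an
  equation, and a triangle has degrees equal to its density; these two losses of strictness are what
  sets that case apart and make it depend on whether \<open>m\<close> is an integer.

  The recurring obstacle is that \<open>m\<close> is real while \<open>k\<close> is integral.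
  Covering \<open>G\<close> takes \<open>m\<close> rounded up many pseudoforests, or
  \<open>m + 1 / 2\<close> rounded up many forests, and the slack in the inequalities has to absorb
  the rounding. For complete bipartite graphs it does not, so \<open>t\<close> is used as a fine
  adjustment. It may then exceed \<open>L\<close>, in which case tight sets can share a vertex, and
  a bound on single vertex sets no longer suffices: whole overlapping families have to be counted.
  The tight sets of the forest stay disjoint, which is why the two classes play different roles in
  the partition theorem.\<close>

definition induced_edges :: "'a set set \<Rightarrow> 'a set \<Rightarrow> 'a set set" where
  "induced_edges E S = {e \<in> E. e \<subseteq> S}"

text \<open>The independent sets of a count matroid, as in rigidity theory. Sets with fewer than two
  vertices are exempt so that \<open>t\<close> may exceed \<open>k\<close>; a single vertex would
  otherwise violate the bound.\<close>

definition sparse :: "int \<Rightarrow> int \<Rightarrow> 'a set set \<Rightarrow> bool" where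
  "sparse k t I \<longleftrightarrow>
     (\<forall>S. finite S \<longrightarrow> 2 \<le> card S \<longrightarrow> int (card (induced_edges I S)) \<le> k * int (card S) - t)"

lemma induced_edges_mono: "E \<subseteq> F \<Longrightarrow> S \<subseteq> T \<Longrightarrow> induced_edges E S \<subseteq> induced_edges F T"
  by (auto simp: induced_edges_def)

lemma finite_induced_edges [simp]: "finite S \<Longrightarrow> finite (induced_edges E S)"
  by (rule finite_subset[of _ "Pow S"]) (auto simp: induced_edges_def)

lemma induced_edges_Int: "induced_edges E S \<inter> induced_edges E T = induced_edges E (S \<inter> T)"
  by (auto simp: induced_edges_def)

lemma card_induced_edges_le_choose:
  assumes "finite S" "\<forall>e\<in>E. card e = 2"
  shows "card (induced_edges E S) \<le> card S choose 2"
proof -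
  have "induced_edges E S \<subseteq> {e. e \<subseteq> S \<and> card e = 2}"
    using assms by (auto simp: induced_edges_def)
  then have "card (induced_edges E S) \<le> card {e. e \<subseteq> S \<and> card e = 2}"
    using assms by (intro card_mono) auto
  also have "\<dots> = card S choose 2"
    using assms n_subsets by blast
  finally show ?thesis .
qed

lemma induced_edges_empty_if_small:
  assumes "finite S" "card S \<le> 1" "\<forall>e\<in>E. card e = 2"
  shows "induced_edges E S = {}"
proof -
  have "card S choose 2 = 0"
    using assms by simp
  then have "card (induced_edges E S) = 0"
    using card_induced_edges_le_choose[of S E] assms by linarith
  then show ?thesis
    using assms by simp
qed

text \<open>Supermodularity: edges inside \<open>S\<close> or \<open>T\<close> lie inside the union,
  edges inside both lie inside the intersection. This is what uncrosses tight sets.\<close>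

lemma card_induced_edges_Un_Int:
  assumes "finite S" "finite T"
  shows "card (induced_edges E S) + card (induced_edges E T)
     \<le> card (induced_edges E (S \<union> T)) + card (induced_edges E (S \<inter> T))"
proof -
  have "card (induced_edges E S) + card (induced_edges E T)
      = card (induced_edges E S \<union> induced_edges E T) + card (induced_edges E (S \<inter> T))"
    using card_Un_Int[of "induced_edges E S" "induced_edges E T"] assms
    by (simp add: induced_edges_Int)
  moreover have "card (induced_edges E S \<union> induced_edges E T) \<le> card (induced_edges E (S \<union> T))"
    using assms by (intro card_mono) (auto simp: induced_edges_def)
  ultimately show ?thesis
    by simp
qed

lemma sparse_subset:
  assumes "sparse k t I" "J \<subseteq> I"
  shows "sparse k t J"
  unfolding sparse_def
proof (intro allI impI)
  fix S :: "'a set" assume S: "finite S" "2 \<le> card S"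
  have "card (induced_edges J S) \<le> card (induced_edges I S)"
    using S assms(2) by (intro card_mono) (auto simp: induced_edges_def)
  then show "int (card (induced_edges J S)) \<le> k * int (card S) - t"
    using assms(1) S unfolding sparse_def by fastforce
qed

lemma sparse_empty:
  assumes "0 \<le> k" "t \<le> 2 * k"
  shows "sparse k t {}"
  unfolding sparse_def
proof (intro allI impI)
  fix S :: "'a set" assume "finite S" "2 \<le> card S"
  then have "k * 2 \<le> k * int (card S)"
    using assms by (intro mult_left_mono) auto
  then show "int (card (induced_edges {} S)) \<le> k * int (card S) - t"
    using assms by (simp add: induced_edges_def)
qed

text \<open>An edge has two vertices, so sets that share at most one vertex never span a common
  edge.\<close>

lemma card_Union_induced_edges:
  assumes "finite B" "\<And>S. S \<in> B \<Longrightarrow> finite S" "\<forall>e\<in>X. card e = 2"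
    and "\<And>S T. S \<in> B \<Longrightarrow> T \<in> B \<Longrightarrow> S \<noteq> T \<Longrightarrow> card (S \<inter> T) \<le> 1"
  shows "card (\<Union>S\<in>B. induced_edges X S) = (\<Sum>S\<in>B. card (induced_edges X S))"
  using assms by (intro card_UN_disjoint)
    (auto simp: induced_edges_Int induced_edges_empty_if_small)

text \<open>The sets in the family below are the maximal sets on which \<^term>\<open>I\<close> is tight.\<close>

lemma maximal_sparse_blocks:
  assumes "finite W" "X \<subseteq> Pow W" "\<forall>e\<in>X. card e = 2"
    and "I \<subseteq> X" "sparse k t I" "\<And>x. x \<in> X - I \<Longrightarrow> \<not> sparse k t (insert x I)" "0 \<le> k"
  obtains B where "finite B" "B \<subseteq> Pow W" "\<And>S. S \<in> B \<Longrightarrow> 2 \<le> card S"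
    "\<And>S T. S \<in> B \<Longrightarrow> T \<in> B \<Longrightarrow> S \<noteq> T \<Longrightarrow> card (S \<inter> T) \<le> 1"
    "\<And>S T. S \<in> B \<Longrightarrow> T \<in> B \<Longrightarrow> S \<noteq> T \<Longrightarrow> t \<le> k \<Longrightarrow> S \<inter> T = {}"
    "int (card I) = int (card (X - (\<Union>S\<in>B. induced_edges X S))) + (\<Sum>S\<in>B. k * int (card S) - t)"
proof -
  define tight where "tight = (\<lambda>S. S \<subseteq> W \<and> 2 \<le> card S \<and> int (card (induced_edges I S)) = k * int (card S) - t)"
  define B where "B = {S. tight S \<and> (\<forall>T. tight T \<longrightarrow> S \<subseteq> T \<longrightarrow> T = S)}"
  have finX: "finite X"
    using assms finite_subset by blast
  have finI: "finite I"
    using finX assms(4) finite_subset by blast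
  have BW: "B \<subseteq> Pow W"
    by (auto simp: B_def tight_def)
  then have finB: "finite B"
    using assms(1) finite_subset by blast
  have fin: "finite S" if "tight S" for S
    using that assms(1) finite_subset by (auto simp: tight_def)
  have upper: "int (card (induced_edges I S)) \<le> k * int (card S) - t" if "finite S" "2 \<le> card S" for S
    using assms(5) that by (simp add: sparse_def)
  \<comment> \<open>Supermodularity gives a tight union as soon as the intersection obeys the
    sparsity bound. An intersection of one or no vertex spans no edge, so there the bound only asks
    for \<open>t \<le> k\<close> or \<open>t \<le> 0\<close>.\<close>
  have join: "tight (S \<union> T)" if S: "tight S" and T: "tight T"
    and large: "2 \<le> card (S \<inter> T) \<or> (card (S \<inter> T) = 1 \<and> t \<le> k) \<or> (card (S \<inter> T) = 0 \<and> t \<le> 0)" for S T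
  proof -
    have f: "finite S" "finite T"
      using fin S T by auto
    have "card S \<le> card (S \<union> T)"
      using f by (intro card_mono) auto
    then have two: "2 \<le> card (S \<union> T)"
      using S by (simp add: tight_def)
    have c: "int (card S) + int (card T) = int (card (S \<union> T)) + int (card (S \<inter> T))"
      using card_Un_Int[OF f] by simp
    have ck: "k * int (card S) + k * int (card T) = k * int (card (S \<union> T)) + k * int (card (S \<inter> T))"
      using arg_cong[OF c, of "\<lambda>x. k * x"] by (simp add: algebra_simps)
    have up: "int (card (induced_edges I (S \<inter> T))) \<le> k * int (card (S \<inter> T)) - t"
    proof (cases "2 \<le> card (S \<inter> T)")
      case True
      then show ?thesis
        using upper f by simp
    next
      case False
      then have "induced_edges I (S \<inter> T) = {}"
        using f assms(3,4) by (intro induced_edges_empty_if_small) auto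
      then show ?thesis
        using False large by auto
    qed
    have "k * int (card (S \<union> T)) - t \<le> int (card (induced_edges I (S \<union> T)))"
      using card_induced_edges_Un_Int[OF f, of I] S T ck up by (simp add: tight_def)
    then show ?thesis
      using upper[of "S \<union> T"] f two S T by (auto simp: tight_def)
  qed
  have pair: "card (S \<inter> T) \<le> 1" if "S \<in> B" "T \<in> B" "S \<noteq> T" for S T
  proof (rule ccontr)
    assume "\<not> card (S \<inter> T) \<le> 1"
    then have "tight (S \<union> T)"
      using join that by (simp add: B_def)
    then have "S \<union> T = S" "S \<union> T = T"
      using that unfolding B_def by blast+
    then show False
      using that by auto
  qed
  have disj: "S \<inter> T = {}" if "S \<in> B" "T \<in> B" "S \<noteq> T" "t \<le> k" for S T
  proof (rule ccontr)
    assume "S \<inter> T \<noteq> {}"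
    moreover have "finite (S \<inter> T)"
      using that fin by (auto simp: B_def)
    ultimately have "0 < card (S \<inter> T)"
      by (simp add: card_gt_0_iff)
    then have "card (S \<inter> T) = 1"
      using pair[OF that(1-3)] by simp
    then have "tight (S \<union> T)"
      using join that by (simp add: B_def)
    then have "S \<union> T = S" "S \<union> T = T"
      using that unfolding B_def by blast+
    then show False
      using that by auto
  qed
  have extend: "\<exists>T\<in>B. S \<subseteq> T" if S: "tight S" for S
  proof -
    have "finite {T. tight T \<and> S \<subseteq> T}"
      by (rule finite_subset[of _ "Pow W"]) (use assms(1) in \<open>auto simp: tight_def\<close>)
    moreover have "S \<in> {T. tight T \<and> S \<subseteq> T}"
      using S by simp
    ultimately obtain T where T: "T \<in> {T. tight T \<and> S \<subseteq> T}"
      "\<forall>U\<in>{T. tight T \<and> S \<subseteq> T}. T \<subseteq> U \<longrightarrow> T = U"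
      using finite_has_maximal2 by (metis (no_types, lifting))
    then have "T \<in> B"
      unfolding B_def by (auto 0 3)
    then show ?thesis
      using T by auto
  qed
  have cover: "\<exists>S\<in>B. x \<subseteq> S" if x: "x \<in> X - I" for x
  proof -
    obtain S where S: "finite S" "2 \<le> card S" "int (card (induced_edges (insert x I) S)) > k * int (card S) - t"
      using assms(6)[OF x] by (auto simp: sparse_def not_le)
    have xS: "x \<subseteq> S"
    proof (rule ccontr)
      assume "\<not> x \<subseteq> S"
      then have "induced_edges (insert x I) S = induced_edges I S"
        by (auto simp: induced_edges_def)
      then show False
        using upper[OF S(1,2)] S(3) by simp
    qed
    have eq: "induced_edges (insert x I) S = insert x (induced_edges I S)"
      using xS by (auto simp: induced_edges_def)
    have xW: "x \<subseteq> S \<inter> W"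
      using x xS assms(2) by auto
    have eqW: "induced_edges I S = induced_edges I (S \<inter> W)"
      using assms(2,4) by (auto simp: induced_edges_def)
    have f: "finite (S \<inter> W)"
      using S by simp
    have two: "2 \<le> card (S \<inter> W)"
      using card_mono[OF f xW] x assms(3) by auto
    \<comment> \<open>The violating set \<open>S\<close> may leave \<open>W\<close>. Restricting it
      to \<open>W\<close> loses no edge and does not raise the bound, and since only one edge was
      added, \<open>S \<inter> W\<close> is exactly tight.\<close>
    have "k * int (card (S \<inter> W)) \<le> k * int (card S)"
      using card_mono[of S "S \<inter> W"] S(1) assms(7) by (intro mult_left_mono) auto
    moreover have "card (insert x (induced_edges I S)) \<le> card (induced_edges I S) + 1"
      by (metis Suc_eq_plus1 card_insert_le_m1 card_insert_if finite_induced_edges S(1) le_add1 order_refl)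
    ultimately have "int (card (induced_edges I (S \<inter> W))) = k * int (card (S \<inter> W)) - t"
      using upper[OF f two] S(3) eq eqW by simp
    then have "tight (S \<inter> W)"
      using two by (simp add: tight_def)
    then show ?thesis
      using extend xW by (meson order_trans)
  qed
  define X' where "X' = (\<Union>S\<in>B. induced_edges X S)"
  \<comment> \<open>A rejected edge lies in a block, so all edges outside the blocks belong to
    \<open>I\<close>; inside each block \<open>I\<close> attains the bound.\<close>
  have "X - X' = I - X'"
    using cover assms(4) by (auto simp: X'_def induced_edges_def)
  have IX': "I \<inter> X' = (\<Union>S\<in>B. induced_edges I S)"
    using assms(4) by (auto simp: X'_def induced_edges_def)
  have "card (\<Union>S\<in>B. induced_edges I S) = (\<Sum>S\<in>B. card (induced_edges I S))"
    using finB BW assms(1,3,4) pair by (intro card_Union_induced_edges) (auto intro: finite_subset)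
  then have "int (card (I \<inter> X')) = (\<Sum>S\<in>B. k * int (card S) - t)"
    unfolding IX' by (simp add: B_def tight_def)
  moreover have "card I = card (I - X') + card (I \<inter> X')"
    using finI by (metis Int_Diff_Un Int_Diff_disjoint add.commute card_Un_disjoint finite_Diff finite_Int)
  ultimately have "int (card I) = int (card (X - X')) + (\<Sum>S\<in>B. k * int (card S) - t)"
    using \<open>X - X' = I - X'\<close> by simp
  then have main: "int (card I) = int (card (X - (\<Union>S\<in>B. induced_edges X S))) + (\<Sum>S\<in>B. k * int (card S) - t)"
    unfolding X'_def .
  have "2 \<le> card S" if "S \<in> B" for S
    using that by (simp add: B_def tight_def)
  then show ?thesis
    using that[OF finB BW _ pair disj main] by blast
qed

text \<open>The block count that equals \<open>card I\<close> bounds every sparse \<open>J\<close>: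
  in each block \<open>J\<close> obeys the bound that \<open>I\<close> attains. Hence all maximal
  sparse subsets of \<open>X\<close> have the same size, as the bases of a matroid do.\<close>

lemma card_le_maximal_sparse:
  assumes "finite W" "X \<subseteq> Pow W" "\<forall>e\<in>X. card e = 2"
    and "I \<subseteq> X" "sparse k t I" "\<And>x. x \<in> X - I \<Longrightarrow> \<not> sparse k t (insert x I)" "0 \<le> k"
    and "J \<subseteq> X" "sparse k t J"
  shows "card J \<le> card I"
proof -
  obtain B where B: "finite B" "B \<subseteq> Pow W" "\<And>S. S \<in> B \<Longrightarrow> 2 \<le> card S"
    "\<And>S T. S \<in> B \<Longrightarrow> T \<in> B \<Longrightarrow> S \<noteq> T \<Longrightarrow> card (S \<inter> T) \<le> 1"
    "int (card I) = int (card (X - (\<Union>S\<in>B. induced_edges X S))) + (\<Sum>S\<in>B. k * int (card S) - t)"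
    using maximal_sparse_blocks[OF assms(1-7)] by metis
  have fX: "finite X"
    using assms finite_subset by blast
  have fS: "finite S" if "S \<in> B" for S
    using that B(2) assms(1) by (meson PowD finite_subset subsetD)
  have "J \<subseteq> (X - (\<Union>S\<in>B. induced_edges X S)) \<union> (\<Union>S\<in>B. induced_edges J S)"
    using assms(8) by (auto simp: induced_edges_def)
  then have "card J \<le> card ((X - (\<Union>S\<in>B. induced_edges X S)) \<union> (\<Union>S\<in>B. induced_edges J S))"
    using fX fS B(1) by (intro card_mono) auto
  also have "\<dots> \<le> card (X - (\<Union>S\<in>B. induced_edges X S)) + card (\<Union>S\<in>B. induced_edges J S)"
    by (rule card_Un_le)
  also have "card (\<Union>S\<in>B. induced_edges J S) \<le> (\<Sum>S\<in>B. card (induced_edges J S))"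
    using B(1) by (rule card_UN_le)
  finally have "int (card J) \<le> int (card (X - (\<Union>S\<in>B. induced_edges X S))) + (\<Sum>S\<in>B. int (card (induced_edges J S)))"
    by (simp flip: of_nat_sum of_nat_add)
  also have "(\<Sum>S\<in>B. int (card (induced_edges J S))) \<le> (\<Sum>S\<in>B. k * int (card S) - t)"
    using assms(9) fS B(3) by (intro sum_mono) (auto simp: sparse_def)
  finally show ?thesis
    using B(5) by simp
qed

lemma extend_sparse_to_maximal:
  assumes "finite X" "I \<subseteq> X" "sparse k t I"
  obtains K where "I \<subseteq> K" "K \<subseteq> X" "sparse k t K" "\<And>x. x \<in> X - K \<Longrightarrow> \<not> sparse k t (insert x K)"
proof -
  have "finite {K. I \<subseteq> K \<and> K \<subseteq> X \<and> sparse k t K}"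
    by (rule finite_subset[of _ "Pow X"]) (use assms(1) in auto)
  moreover have "I \<in> {K. I \<subseteq> K \<and> K \<subseteq> X \<and> sparse k t K}"
    using assms by simp
  ultimately obtain K where K: "K \<in> {K. I \<subseteq> K \<and> K \<subseteq> X \<and> sparse k t K}"
    "\<forall>U\<in>{K. I \<subseteq> K \<and> K \<subseteq> X \<and> sparse k t K}. K \<subseteq> U \<longrightarrow> K = U"
    using finite_has_maximal2 by (metis (no_types, lifting))
  have "\<not> sparse k t (insert x K)" if "x \<in> X - K" for x
  proof
    assume "sparse k t (insert x K)"
    then have "insert x K \<in> {K. I \<subseteq> K \<and> K \<subseteq> X \<and> sparse k t K}"
      using K(1) that by auto
    with K(2) have "K \<subseteq> insert x K \<longrightarrow> K = insert x K"
      by (rule bspec)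
    then have "x \<in> K"
      by auto
    then show False
      using that by auto
  qed
  then show ?thesis
    using that[of K] K(1) by blast
qed

section \<open>Rank function of the sparsity matroid\<close>

definition sparse_rank :: "int \<Rightarrow> int \<Rightarrow> 'a set set \<Rightarrow> nat" where
  "sparse_rank k t X = Max (card ` {I. I \<subseteq> X \<and> sparse k t I})"

lemma card_le_sparse_rank:
  assumes "finite X" "I \<subseteq> X" "sparse k t I"
  shows "card I \<le> sparse_rank k t X"
  unfolding sparse_rank_def using assms by (intro Max_ge) auto

lemma sparse_rank_witness:
  assumes "finite X" "0 \<le> k" "t \<le> 2 * k"
  obtains I where "I \<subseteq> X" "sparse k t I" "card I = sparse_rank k t X"
proof -
  have "card ` {I. I \<subseteq> X \<and> sparse k t I} \<noteq> {}"
    using sparse_empty[OF assms(2,3)] by blast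
  moreover have "finite (card ` {I. I \<subseteq> X \<and> sparse k t I})"
    using assms(1) by simp
  ultimately have "sparse_rank k t X \<in> card ` {I. I \<subseteq> X \<and> sparse k t I}"
    unfolding sparse_rank_def by (rule Max_in[rotated])
  then show ?thesis
    using that by auto
qed

lemma sparse_rank_le_card:
  assumes "finite X" "0 \<le> k" "t \<le> 2 * k"
  shows "sparse_rank k t X \<le> card X"
  using sparse_rank_witness[OF assms] assms(1) by (metis card_mono)

lemma sparse_if_sparse_rank_eq_card:
  assumes "finite X" "0 \<le> k" "t \<le> 2 * k" "sparse_rank k t X = card X"
  shows "sparse k t X"
  using sparse_rank_witness[OF assms(1-3)] assms(1,4) by (metis card_subset_eq)

lemma maximal_sparse_card_eq_rank:
  assumes "finite W" "X \<subseteq> Pow W" "\<forall>e\<in>X. card e = 2" "0 \<le> k" "t \<le> 2 * k"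
    and "I \<subseteq> X" "sparse k t I" "\<And>x. x \<in> X - I \<Longrightarrow> \<not> sparse k t (insert x I)"
  shows "card I = sparse_rank k t X"
proof -
  have fX: "finite X"
    using assms finite_subset by blast
  obtain J where J: "J \<subseteq> X" "sparse k t J" "card J = sparse_rank k t X"
    using sparse_rank_witness fX assms(4,5) by blast
  have "card J \<le> card I"
    using card_le_maximal_sparse[OF assms(1-3,6-8,4) J(1,2)] .
  then show ?thesis
    using card_le_sparse_rank[OF fX assms(6,7)] J(3) by simp
qed

text \<open>A largest sparse subset \<open>I\<close> of the intersection extends to a largest one
  \<open>K\<close> of the union. The restrictions of \<open>K\<close> to \<open>X\<close> and to
  \<open>Y\<close> remain sparse, and their overlap contains \<open>I\<close>.\<close>

lemma sparse_rank_submodular: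
  assumes "finite W" "X \<subseteq> Pow W" "Y \<subseteq> Pow W" "\<forall>e\<in>X \<union> Y. card e = 2" "0 \<le> k" "t \<le> 2 * k"
  shows "sparse_rank k t (X \<union> Y) + sparse_rank k t (X \<inter> Y) \<le> sparse_rank k t X + sparse_rank k t Y"
proof -
  have fX: "finite X" "finite Y"
    using assms finite_subset by blast+
  obtain I where I: "I \<subseteq> X \<inter> Y" "sparse k t I" "card I = sparse_rank k t (X \<inter> Y)"
    using sparse_rank_witness[of "X \<inter> Y"] fX assms(5,6) by blast
  obtain K where K: "I \<subseteq> K" "K \<subseteq> X \<union> Y" "sparse k t K" "\<And>x. x \<in> X \<union> Y - K \<Longrightarrow> \<not> sparse k t (insert x K)"
    using extend_sparse_to_maximal[of "X \<union> Y" I k t] I fX by (metis finite_UnI le_infI1 le_supI1 inf_le1 order_trans sup_ge1)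
  have fK: "finite K"
    using K(2) fX finite_subset by blast
  have rank: "sparse_rank k t (X \<union> Y) = card K"
    using maximal_sparse_card_eq_rank[of W "X \<union> Y" k t K] assms K by auto
  have "card K + card I \<le> card K + card (K \<inter> X \<inter> Y)"
    using I K(1) fK by (intro add_left_mono card_mono) auto
  also have "\<dots> = card (K \<inter> X) + card (K \<inter> Y)"
  proof -
    have "(K \<inter> X) \<union> (K \<inter> Y) = K" "(K \<inter> X) \<inter> (K \<inter> Y) = K \<inter> X \<inter> Y"
      using K(2) by auto
    then show ?thesis
      using card_Un_Int[of "K \<inter> X" "K \<inter> Y"] fK by simp
  qed
  also have "\<dots> \<le> sparse_rank k t X + sparse_rank k t Y"
    using fX sparse_subset[OF K(3)] by (intro add_mono card_le_sparse_rank) auto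
  finally show ?thesis
    using I(3) rank by simp
qed

text \<open>Matroid union: \<^term>\<open>A1\<close> and \<^term>\<open>A2\<close> hold the elements
  assigned so far, and if neither choice keeps the hypothesis, the two violating sets uncross.\<close>

lemma partition_by_submodular:
  fixes r1 r2 :: "'e set \<Rightarrow> nat"
  assumes "finite R" "R \<inter> A1 = {}" "R \<inter> A2 = {}" "R \<union> A1 \<union> A2 \<subseteq> U"
    and "\<And>X Y. X \<subseteq> U \<Longrightarrow> Y \<subseteq> U \<Longrightarrow> r1 (X \<union> Y) + r1 (X \<inter> Y) \<le> r1 X + r1 Y"
    and "\<And>X Y. X \<subseteq> U \<Longrightarrow> Y \<subseteq> U \<Longrightarrow> r2 (X \<union> Y) + r2 (X \<inter> Y) \<le> r2 X + r2 Y"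
    and "\<And>X. X \<subseteq> R \<Longrightarrow> card X + a \<le> r1 (X \<union> A1) + r2 (X \<union> A2)"
  shows "\<exists>R1 R2. R1 \<union> R2 = R \<and> R1 \<inter> R2 = {} \<and> card R + a \<le> r1 (R1 \<union> A1) + r2 (R2 \<union> A2)"
  using assms(1-4,7)
proof (induction R arbitrary: A1 A2 a rule: finite_induct)
  case empty
  then show ?case
    using empty.prems(4)[of "{}"] by auto
next
  case (insert e F)
  note hyp = insert.prems(4)
  show ?case
  \<comment> \<open>\<open>a\<close> counts the elements already placed: \<open>e\<close> may join
    the first class if the rank condition survives with \<open>Suc a\<close>.\<close>
  proof (cases "\<forall>X\<subseteq>F. card X + Suc a \<le> r1 (X \<union> insert e A1) + r2 (X \<union> A2)")
    case True
    have "\<exists>R1 R2. R1 \<union> R2 = F \<and> R1 \<inter> R2 = {} \<and> card F + Suc a \<le> r1 (R1 \<union> insert e A1) + r2 (R2 \<union> A2)"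
      by (rule insert.IH) (use insert True in auto)
    then obtain R1 R2 where "R1 \<union> R2 = F" "R1 \<inter> R2 = {}" "card F + Suc a \<le> r1 (R1 \<union> insert e A1) + r2 (R2 \<union> A2)"
      by blast
    then show ?thesis
      using insert.hyps by (intro exI[of _ "insert e R1"] exI[of _ R2]) auto
  next
    case False
    then obtain X where X: "X \<subseteq> F" "r1 (X \<union> insert e A1) + r2 (X \<union> A2) < card X + Suc a"
      by (auto simp: not_le)
    show ?thesis
    proof (cases "\<forall>X\<subseteq>F. card X + Suc a \<le> r1 (X \<union> A1) + r2 (X \<union> insert e A2)")
      case True
      have "\<exists>R1 R2. R1 \<union> R2 = F \<and> R1 \<inter> R2 = {} \<and> card F + Suc a \<le> r1 (R1 \<union> A1) + r2 (R2 \<union> insert e A2)"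
        by (rule insert.IH) (use insert True in auto)
      then obtain R1 R2 where "R1 \<union> R2 = F" "R1 \<inter> R2 = {}" "card F + Suc a \<le> r1 (R1 \<union> A1) + r2 (R2 \<union> insert e A2)"
        by blast
      then show ?thesis
        using insert.hyps by (intro exI[of _ R1] exI[of _ "insert e R2"]) auto
    next
      case False
      then obtain Y where Y: "Y \<subseteq> F" "r1 (Y \<union> A1) + r2 (Y \<union> insert e A2) < card Y + Suc a"
        by (auto simp: not_le)
      have fin: "finite X" "finite Y"
        using X Y insert.hyps finite_subset by auto
      have e: "e \<notin> X" "e \<notin> Y"
        using X Y insert.hyps by auto
      have sub: "X \<subseteq> U" "Y \<subseteq> U" "A1 \<subseteq> U" "A2 \<subseteq> U" "e \<in> U"
        using X Y insert.prems by auto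
      have i1: "(X \<union> insert e A1) \<inter> (Y \<union> A1) = (X \<inter> Y) \<union> A1"
        using e insert.prems(1) by auto
      have i2: "(X \<union> A2) \<inter> (Y \<union> insert e A2) = (X \<inter> Y) \<union> A2"
        using e insert.prems(2) by auto
      have u1: "(X \<union> insert e A1) \<union> (Y \<union> A1) = insert e (X \<union> Y) \<union> A1"
        by auto
      have u2: "(X \<union> A2) \<union> (Y \<union> insert e A2) = insert e (X \<union> Y) \<union> A2"
        by auto
      \<comment> \<open>The two violations bound the four ranks on the right by
        \<open>card X + card Y + 2 * a\<close> in total. The hypothesis at
        \<open>insert e (X \<union> Y)\<close> and at \<open>X \<inter> Y\<close> demands one more,
        on account of \<open>e\<close>.\<close>
      have "r1 (insert e (X \<union> Y) \<union> A1) + r1 ((X \<inter> Y) \<union> A1) \<le> r1 (X \<union> insert e A1) + r1 (Y \<union> A1)"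
        using assms(5)[of "X \<union> insert e A1" "Y \<union> A1"] sub by (simp only: i1 u1) auto
      moreover have "r2 (insert e (X \<union> Y) \<union> A2) + r2 ((X \<inter> Y) \<union> A2) \<le> r2 (X \<union> A2) + r2 (Y \<union> insert e A2)"
        using assms(6)[of "X \<union> A2" "Y \<union> insert e A2"] sub by (simp only: i2 u2) auto
      moreover have "card (insert e (X \<union> Y)) + a \<le> r1 (insert e (X \<union> Y) \<union> A1) + r2 (insert e (X \<union> Y) \<union> A2)"
        using X Y by (intro hyp) auto
      moreover have "card (X \<inter> Y) + a \<le> r1 ((X \<inter> Y) \<union> A1) + r2 ((X \<inter> Y) \<union> A2)"
        using X Y by (intro hyp) auto
      moreover have "card (insert e (X \<union> Y)) = Suc (card (X \<union> Y))"
        using e fin by simp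
      ultimately show ?thesis
        using X Y card_Un_Int[OF fin] by linarith
    qed
  qed
qed

text \<open>Sparse sets on disjoint vertex sets unite to a sparse set: a vertex set that meets
  several parts loses \<open>t\<close> in each of them, which for nonnegative \<open>t\<close> is
  stronger than losing it once.\<close>

lemma sparse_rank_vertex_disjoint:
  assumes "finite P" "\<And>W. W \<in> P \<Longrightarrow> finite W" "\<And>W W'. W \<in> P \<Longrightarrow> W' \<in> P \<Longrightarrow> W \<noteq> W' \<Longrightarrow> W \<inter> W' = {}"
    and "\<forall>e\<in>X. card e = 2" "finite X" "0 \<le> k" "0 \<le> t" "t \<le> 2 * k"
  shows "(\<Sum>W\<in>P. sparse_rank k t (induced_edges X W)) \<le> sparse_rank k t X"
proof -
  have "\<exists>I. I \<subseteq> induced_edges X W \<and> sparse k t I \<and> card I = sparse_rank k t (induced_edges X W)" if "W \<in> P" for W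
    using sparse_rank_witness[OF finite_induced_edges[OF assms(2)[OF that]] assms(6,8)] by metis
  then obtain I where I: "\<And>W. W \<in> P \<Longrightarrow> I W \<subseteq> induced_edges X W" "\<And>W. W \<in> P \<Longrightarrow> sparse k t (I W)"
    "\<And>W. W \<in> P \<Longrightarrow> card (I W) = sparse_rank k t (induced_edges X W)"
    by metis
  define K where "K = (\<Union>W\<in>P. I W)"
  have KX: "K \<subseteq> X"
    using I(1) by (auto simp: K_def induced_edges_def)
  have cX: "\<And>e. e \<in> X \<Longrightarrow> e \<noteq> {}"
    using assms(4) by fastforce
  have "card K = (\<Sum>W\<in>P. card (I W))"
    unfolding K_def
  proof (rule card_UN_disjoint)
    show "\<forall>W\<in>P. finite (I W)"
      using I(1) assms(2) by (meson finite_induced_edges finite_subset)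
    show "\<forall>i\<in>P. \<forall>j\<in>P. i \<noteq> j \<longrightarrow> I i \<inter> I j = {}"
    proof (intro ballI impI)
      fix i j assume ij: "i \<in> P" "j \<in> P" "i \<noteq> j"
      then have "i \<inter> j = {}" "I i \<subseteq> induced_edges X i" "I j \<subseteq> induced_edges X j"
        using assms(3) I(1) by blast+
      then have "e \<in> X \<and> e \<subseteq> i \<inter> j" if "e \<in> I i \<inter> I j" for e
        using that unfolding induced_edges_def by blast
      then show "I i \<inter> I j = {}"
        using cX \<open>i \<inter> j = {}\<close> by blast
    qed
  qed (rule assms(1))
  moreover have "sparse k t K"
    unfolding sparse_def
  proof (intro allI impI)
    fix S :: "'a set" assume S: "finite S" "2 \<le> card S"
    \<comment> \<open>Only parts that meet \<open>S\<close> in two vertices contribute edges, and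
      only for these does sparsity give a bound.\<close>
    define Q where "Q = {W \<in> P. 2 \<le> card (S \<inter> W)}"
    have "induced_edges K S \<subseteq> (\<Union>W\<in>Q. induced_edges (I W) (S \<inter> W))"
    proof
      fix e assume "e \<in> induced_edges K S"
      then obtain W where W: "W \<in> P" "e \<in> I W" "e \<subseteq> S"
        by (auto simp: induced_edges_def K_def)
      then have "e \<in> induced_edges X W"
        using I(1) by blast
      then have "e \<subseteq> S \<inter> W" "card e = 2"
        using W assms(4) by (auto simp: induced_edges_def)
      moreover have "card e \<le> card (S \<inter> W)"
        using \<open>e \<subseteq> S \<inter> W\<close> S(1) by (intro card_mono) auto
      ultimately show "e \<in> (\<Union>W\<in>Q. induced_edges (I W) (S \<inter> W))"
        using W by (auto simp: Q_def induced_edges_def)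
    qed
    then have "card (induced_edges K S) \<le> card (\<Union>W\<in>Q. induced_edges (I W) (S \<inter> W))"
      using assms(1) S by (intro card_mono) (auto simp: Q_def)
    also have "\<dots> \<le> (\<Sum>W\<in>Q. card (induced_edges (I W) (S \<inter> W)))"
      using assms(1) by (intro card_UN_le) (auto simp: Q_def)
    finally have "int (card (induced_edges K S)) \<le> (\<Sum>W\<in>Q. int (card (induced_edges (I W) (S \<inter> W))))"
      by (simp flip: of_nat_sum)
    also have "\<dots> \<le> (\<Sum>W\<in>Q. k * int (card (S \<inter> W)) - t)"
      using I(2) S(1) by (intro sum_mono) (auto simp: Q_def sparse_def)
    also have "\<dots> = k * int (\<Sum>W\<in>Q. card (S \<inter> W)) - int (card Q) * t"
      by (simp add: sum_subtractf sum_distrib_left)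
    also have "(\<Sum>W\<in>Q. card (S \<inter> W)) = card (\<Union>W\<in>Q. S \<inter> W)"
      using assms(1,3) S(1) by (intro card_UN_disjoint[symmetric]) (auto simp: Q_def)
    also have "k * int (card (\<Union>W\<in>Q. S \<inter> W)) - int (card Q) * t \<le> k * int (card S) - t"
    proof (cases "Q = {}")
      case True
      have "k * 2 \<le> k * int (card S)"
        using S assms(6) by (intro mult_left_mono) auto
      then show ?thesis
        using True assms(8) by simp
    next
      case False
      then have "1 \<le> card Q"
        using assms(1) by (simp add: Q_def card_gt_0_iff Suc_le_eq)
      then have "1 * t \<le> int (card Q) * t"
        using assms(7) by (intro mult_right_mono) auto
      moreover have "k * int (card (\<Union>W\<in>Q. S \<inter> W)) \<le> k * int (card S)"
        using assms(6) S(1) by (intro mult_left_mono) (auto intro!: card_mono)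
      ultimately show ?thesis
        by simp
    qed
    finally show "int (card (induced_edges K S)) \<le> k * int (card S) - t" .
  qed
  ultimately show ?thesis
    using card_le_sparse_rank[OF assms(5) KX] I(3) by simp
qed

text \<open>\<open>t1 \<le> k1\<close> makes the tight blocks of the first class vertex-disjoint, so
  the matroid union condition on \<open>X\<close> can be checked inside a single block
  \<open>W\<close>. There the tight blocks of the second class form the family \<open>B\<close>.
  They may share a vertex when \<open>t2\<close> exceeds \<open>k2\<close>, and so the density
  condition speaks of families instead of single sets.\<close>

theorem partition_into_two_sparse:
  assumes "finite V" "E \<subseteq> Pow V" "\<forall>e\<in>E. card e = 2"
    and "0 \<le> k1" "t1 \<le> k1" "0 \<le> k2" "0 \<le> t2" "t2 \<le> 2 * k2"
    and dens: "\<And>W B. W \<subseteq> V \<Longrightarrow> 2 \<le> card W \<Longrightarrow> finite B \<Longrightarrow> B \<subseteq> Pow W \<Longrightarrow> (\<And>S. S \<in> B \<Longrightarrow> 2 \<le> card S)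
      \<Longrightarrow> (\<And>S T. S \<in> B \<Longrightarrow> T \<in> B \<Longrightarrow> S \<noteq> T \<Longrightarrow> card (S \<inter> T) \<le> 1)
      \<Longrightarrow> (\<And>S T. S \<in> B \<Longrightarrow> T \<in> B \<Longrightarrow> S \<noteq> T \<Longrightarrow> t2 \<le> k2 \<Longrightarrow> S \<inter> T = {})
      \<Longrightarrow> (\<Sum>S\<in>B. int (card (induced_edges E S))) \<le> k1 * int (card W) - t1 + (\<Sum>S\<in>B. k2 * int (card S) - t2)"
  obtains I1 I2 where "I1 \<union> I2 = E" "I1 \<inter> I2 = {}" "sparse k1 t1 I1" "sparse k2 t2 I2"
proof -
  have finE: "finite E"
    using assms(1,2) finite_subset by blast
  have k1: "t1 \<le> 2 * k1"
    using assms(4,5) by simp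
  \<comment> \<open>Edges outside the blocks of the second class count fully in its rank, so only
    the edges inside \<open>B\<close> have to be paid for by \<open>dens\<close>.\<close>
  have local: "int (card (induced_edges X W)) \<le> k1 * int (card W) - t1 + int (sparse_rank k2 t2 (induced_edges X W))"
    if X: "X \<subseteq> E" and W: "W \<subseteq> V" "2 \<le> card W" for X W
  proof -
    define Y where "Y = induced_edges X W"
    have fW: "finite W"
      using W assms(1) finite_subset by blast
    have Y: "Y \<subseteq> Pow W" "\<forall>e\<in>Y. card e = 2" "Y \<subseteq> E"
      using X assms(3) by (auto simp: Y_def induced_edges_def)
    have fY: "finite Y"
      using Y(1) fW finite_subset by blast
    obtain I where I: "{} \<subseteq> I" "I \<subseteq> Y" "sparse k2 t2 I" "\<And>x. x \<in> Y - I \<Longrightarrow> \<not> sparse k2 t2 (insert x I)"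
      using extend_sparse_to_maximal[OF fY empty_subsetI sparse_empty] assms(6,8) by metis
    obtain B where B: "finite B" "B \<subseteq> Pow W" "\<And>S. S \<in> B \<Longrightarrow> 2 \<le> card S"
      "\<And>S T. S \<in> B \<Longrightarrow> T \<in> B \<Longrightarrow> S \<noteq> T \<Longrightarrow> card (S \<inter> T) \<le> 1"
      "\<And>S T. S \<in> B \<Longrightarrow> T \<in> B \<Longrightarrow> S \<noteq> T \<Longrightarrow> t2 \<le> k2 \<Longrightarrow> S \<inter> T = {}"
      "int (card I) = int (card (Y - (\<Union>S\<in>B. induced_edges Y S))) + (\<Sum>S\<in>B. k2 * int (card S) - t2)"
      using maximal_sparse_blocks[OF fW Y(1,2) I(2-4) assms(6)] by metis
    have fS: "finite S" if "S \<in> B" for S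
      using that B(2) fW by (meson PowD finite_subset subsetD)
    have "(\<Union>S\<in>B. induced_edges Y S) \<subseteq> Y"
      by (auto simp: induced_edges_def)
    then have "card Y = card (Y - (\<Union>S\<in>B. induced_edges Y S)) + card (\<Union>S\<in>B. induced_edges Y S)"
      using fY by (metis Diff_disjoint Diff_partition Int_commute add.commute card_Un_disjoint finite_Diff finite_subset)
    also have "card (\<Union>S\<in>B. induced_edges Y S) = (\<Sum>S\<in>B. card (induced_edges Y S))"
      using B fS Y(2) by (intro card_Union_induced_edges) auto
    also have "\<dots> \<le> (\<Sum>S\<in>B. card (induced_edges E S))"
      using fS Y(3) by (intro sum_mono card_mono induced_edges_mono) auto
    finally have "int (card Y) \<le> int (card (Y - (\<Union>S\<in>B. induced_edges Y S))) + (\<Sum>S\<in>B. int (card (induced_edges E S)))"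
      by (simp flip: of_nat_sum of_nat_add)
    also have "(\<Sum>S\<in>B. int (card (induced_edges E S))) \<le> k1 * int (card W) - t1 + (\<Sum>S\<in>B. k2 * int (card S) - t2)"
      using W B by (intro dens) auto
    finally have "int (card Y) \<le> k1 * int (card W) - t1 + int (card I)"
      using B(6) by simp
    moreover have "card I = sparse_rank k2 t2 Y"
      using maximal_sparse_card_eq_rank[OF fW Y(1,2) assms(6,8) I(2-4)] by simp
    ultimately show ?thesis
      by (simp add: Y_def)
  qed
  have rank: "card X \<le> sparse_rank k1 t1 X + sparse_rank k2 t2 X" if X: "X \<subseteq> E" for X
  proof -
    have X': "X \<subseteq> Pow V" "\<forall>e\<in>X. card e = 2"
      using X assms(2,3) by auto
    have fX: "finite X"
      using X finE finite_subset by blast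
    obtain I where I: "{} \<subseteq> I" "I \<subseteq> X" "sparse k1 t1 I" "\<And>x. x \<in> X - I \<Longrightarrow> \<not> sparse k1 t1 (insert x I)"
      using extend_sparse_to_maximal[OF fX empty_subsetI sparse_empty] assms(4) k1 by metis
    obtain B where B: "finite B" "B \<subseteq> Pow V" "\<And>S. S \<in> B \<Longrightarrow> 2 \<le> card S"
      "\<And>S T. S \<in> B \<Longrightarrow> T \<in> B \<Longrightarrow> S \<noteq> T \<Longrightarrow> card (S \<inter> T) \<le> 1"
      "\<And>S T. S \<in> B \<Longrightarrow> T \<in> B \<Longrightarrow> S \<noteq> T \<Longrightarrow> t1 \<le> k1 \<Longrightarrow> S \<inter> T = {}"
      "int (card I) = int (card (X - (\<Union>S\<in>B. induced_edges X S))) + (\<Sum>S\<in>B. k1 * int (card S) - t1)"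
      using maximal_sparse_blocks[OF assms(1) X' I(2-4) assms(4)] by metis
    have fS: "finite S" if "S \<in> B" for S
      using that B(2) assms(1) by (meson PowD finite_subset subsetD)
    have "(\<Union>S\<in>B. induced_edges X S) \<subseteq> X"
      by (auto simp: induced_edges_def)
    then have "card X = card (X - (\<Union>S\<in>B. induced_edges X S)) + card (\<Union>S\<in>B. induced_edges X S)"
      using fX by (metis Diff_disjoint Diff_partition Int_commute add.commute card_Un_disjoint finite_Diff finite_subset)
    also have "card (\<Union>S\<in>B. induced_edges X S) = (\<Sum>S\<in>B. card (induced_edges X S))"
      using B fS X'(2) by (intro card_Union_induced_edges) auto
    finally have "int (card X) = int (card (X - (\<Union>S\<in>B. induced_edges X S))) + (\<Sum>S\<in>B. int (card (induced_edges X S)))"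
      by simp
    also have "(\<Sum>S\<in>B. int (card (induced_edges X S)))
        \<le> (\<Sum>S\<in>B. (k1 * int (card S) - t1) + int (sparse_rank k2 t2 (induced_edges X S)))"
      using B X by (intro sum_mono local) auto
    also have "\<dots> = (\<Sum>S\<in>B. k1 * int (card S) - t1) + int (\<Sum>S\<in>B. sparse_rank k2 t2 (induced_edges X S))"
      by (simp only: sum.distrib of_nat_sum)
    \<comment> \<open>This is where the disjointness of the blocks of the first class is
      used.\<close>
    also have "(\<Sum>S\<in>B. sparse_rank k2 t2 (induced_edges X S)) \<le> sparse_rank k2 t2 X"
      using B fS X'(2) fX assms(5-8) by (intro sparse_rank_vertex_disjoint) auto
    finally have "int (card X) \<le> int (card I) + int (sparse_rank k2 t2 X)"
      using B(6) by simp
    moreover have "card I = sparse_rank k1 t1 X"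
      using maximal_sparse_card_eq_rank[OF assms(1) X' assms(4) k1 I(2-4)] by simp
    ultimately show ?thesis
      by simp
  qed
  have "\<exists>R1 R2. R1 \<union> R2 = E \<and> R1 \<inter> R2 = {} \<and> card E + 0 \<le> sparse_rank k1 t1 (R1 \<union> {}) + sparse_rank k2 t2 (R2 \<union> {})"
  proof (rule partition_by_submodular[where U = E])
    fix X Y assume "X \<subseteq> E" "Y \<subseteq> E"
    then have XY: "X \<subseteq> Pow V" "Y \<subseteq> Pow V" "\<forall>e\<in>X \<union> Y. card e = 2"
      using assms(2,3) by auto
    show "sparse_rank k1 t1 (X \<union> Y) + sparse_rank k1 t1 (X \<inter> Y) \<le> sparse_rank k1 t1 X + sparse_rank k1 t1 Y"
      using sparse_rank_submodular[OF assms(1) XY assms(4) k1] .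
    show "sparse_rank k2 t2 (X \<union> Y) + sparse_rank k2 t2 (X \<inter> Y) \<le> sparse_rank k2 t2 X + sparse_rank k2 t2 Y"
      using sparse_rank_submodular[OF assms(1) XY assms(6,8)] .
  qed (use finE rank in auto)
  then obtain I1 I2 where I: "I1 \<union> I2 = E" "I1 \<inter> I2 = {}" "card E \<le> sparse_rank k1 t1 I1 + sparse_rank k2 t2 I2"
    by auto
  have fI: "finite I1" "finite I2"
    using I(1) finE by auto
  have "card E = card I1 + card I2"
    using I fI card_Un_disjoint by blast
  \<comment> \<open>A rank never exceeds the size, so the sum reaches \<open>card E\<close> only if
    both classes are independent.\<close>
  then have "sparse_rank k1 t1 I1 = card I1" "sparse_rank k2 t2 I2 = card I2"
    using sparse_rank_le_card[OF fI(1) assms(4) k1] sparse_rank_le_card[OF fI(2) assms(6,8)] I(3) by auto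
  then have "sparse k1 t1 I1" "sparse k2 t2 I2"
    using sparse_if_sparse_rank_eq_card[OF fI(1) assms(4) k1] sparse_if_sparse_rank_eq_card[OF fI(2) assms(6,8)]
    by auto
  then show ?thesis
    using that I by blast
qed

text \<open>With \<open>t2 \<le> k2\<close> the members of \<open>B\<close> are disjoint. Summing
  the bound for single sets over a nonempty \<open>B\<close> subtracts \<open>t1\<close> once per
  member, hence at least the one \<open>t1\<close> that is required.\<close>

lemma partition_into_two_sparse_local:
  assumes "finite V" "E \<subseteq> Pow V" "\<forall>e\<in>E. card e = 2"
    and "0 \<le> t1" "t1 \<le> k1" "0 \<le> t2" "t2 \<le> k2"
    and dens: "\<And>S. S \<subseteq> V \<Longrightarrow> 2 \<le> card S \<Longrightarrow> int (card (induced_edges E S)) \<le> (k1 + k2) * int (card S) - t1 - t2"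
  obtains I1 I2 where "I1 \<union> I2 = E" "I1 \<inter> I2 = {}" "sparse k1 t1 I1" "sparse k2 t2 I2"
proof (rule partition_into_two_sparse[OF assms(1-3)])
  fix W B
  assume W: "W \<subseteq> V" "2 \<le> card W" and B: "finite B" "B \<subseteq> Pow W" "\<And>S. S \<in> B \<Longrightarrow> 2 \<le> card S"
    "\<And>S T. S \<in> B \<Longrightarrow> T \<in> B \<Longrightarrow> S \<noteq> T \<Longrightarrow> card (S \<inter> T) \<le> 1"
    "\<And>S T. S \<in> B \<Longrightarrow> T \<in> B \<Longrightarrow> S \<noteq> T \<Longrightarrow> t2 \<le> k2 \<Longrightarrow> S \<inter> T = {}"
  have fW: "finite W"
    using W assms(1) finite_subset by blast
  have "(\<Sum>S\<in>B. int (card (induced_edges E S))) \<le> (\<Sum>S\<in>B. (k1 * int (card S) - t1) + (k2 * int (card S) - t2))"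
    using B W dens by (intro sum_mono) (force simp: algebra_simps)
  also have "\<dots> = (\<Sum>S\<in>B. k1 * int (card S) - t1) + (\<Sum>S\<in>B. k2 * int (card S) - t2)"
    by (rule sum.distrib)
  also have "(\<Sum>S\<in>B. k1 * int (card S) - t1) \<le> k1 * int (card W) - t1"
  proof (cases "B = {}")
    case True
    have "k1 * 1 \<le> k1 * int (card W)"
      using W(2) assms(4,5) by (intro mult_left_mono) auto
    then show ?thesis
      using True assms(5) by simp
  next
    case False
    have "finite S" if "S \<in> B" for S
      using that B(2) fW by (meson PowD finite_subset subsetD)
    then have "(\<Sum>S\<in>B. card S) = card (\<Union>B)"
      using card_UN_disjoint[of B "\<lambda>S. S"] B(1,5) assms(7) by simp
    also have "\<dots> \<le> card W"
      using B(2) fW by (intro card_mono) auto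
    finally have "int (\<Sum>S\<in>B. card S) \<le> int (card W)"
      by (simp only: of_nat_le_iff)
    then have "k1 * int (\<Sum>S\<in>B. card S) \<le> k1 * int (card W)"
      using assms(4,5) by (intro mult_left_mono) auto
    moreover have "1 * t1 \<le> int (card B) * t1"
      using False B(1) assms(4) by (intro mult_right_mono) (auto simp: card_gt_0_iff Suc_le_eq)
    ultimately show ?thesis
      by (simp add: sum_subtractf sum_distrib_left)
  qed
  finally show "(\<Sum>S\<in>B. int (card (induced_edges E S))) \<le> k1 * int (card W) - t1 + (\<Sum>S\<in>B. k2 * int (card S) - t2)"
    by simp
qed (use assms that in auto)

section \<open>A forest and a sparse edge set\<close>

lemma sum_card_Int_eq_sum_multiplicity:
  assumes "finite B" "finite T"
  shows "(\<Sum>S\<in>B. card (S \<inter> T)) = (\<Sum>u\<in>T. card {S \<in> B. u \<in> S})"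
proof -
  have "(\<Sum>S\<in>B. card (S \<inter> T)) = (\<Sum>S\<in>B. \<Sum>u\<in>T. if u \<in> S then 1 else 0)"
  proof (rule sum.cong[OF refl])
    fix S
    have "(\<Sum>u\<in>T. if u \<in> S then 1 else 0) = (\<Sum>u\<in>T \<inter> S. 1::nat)"
      using assms(2) by (rule sum.inter_restrict[symmetric])
    then show "card (S \<inter> T) = (\<Sum>u\<in>T. if u \<in> S then 1 else 0)"
      by (simp add: Int_commute)
  qed
  also have "\<dots> = (\<Sum>u\<in>T. \<Sum>S\<in>B. if u \<in> S then 1 else 0)"
    by (rule sum.swap)
  also have "\<dots> = (\<Sum>u\<in>T. card {S \<in> B. u \<in> S})"
  proof (rule sum.cong[OF refl])
    fix u
    have "(\<Sum>S\<in>B. if u \<in> S then 1 else 0) = (\<Sum>S\<in>{S \<in> B. u \<in> S}. 1::nat)"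
      using assms(1) by (rule sum.inter_filter[symmetric])
    then show "(\<Sum>S\<in>B. if u \<in> S then 1 else 0) = card {S \<in> B. u \<in> S}"
      by simp
  qed
  finally show ?thesis .
qed

text \<open>Each member contains at least two vertices of multiplicity 2 or more, where
  \<open>deg u \<le> 2 * (deg u - 1)\<close>. Counting these incidences bounds \<open>card B\<close>
  by the total of \<open>deg u - 1\<close> over the union, which is the sum of the sizes minus the
  size of the union.\<close>

lemma card_Union_overlapping_family:
  assumes "finite B" "\<And>S. S \<in> B \<Longrightarrow> finite S" "\<And>S. S \<in> B \<Longrightarrow> 2 \<le> card (S \<inter> \<Union>(B - {S}))"
  shows "card (\<Union>B) + card B \<le> (\<Sum>S\<in>B. card S)"
proof -
  define U where "U = \<Union>B"
  define deg where "deg = (\<lambda>u. card {S \<in> B. u \<in> S})"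
  define Sh where "Sh = {u \<in> U. 2 \<le> deg u}"
  have fU: "finite U" and fSh: "finite Sh"
    using assms(1,2) by (auto simp: U_def Sh_def)
  have pos: "1 \<le> deg u" if "u \<in> U" for u
    using that assms(1) by (auto simp: U_def deg_def Suc_le_eq card_gt_0_iff)
  have "2 \<le> card (S \<inter> Sh)" if S: "S \<in> B" for S
  proof -
    have "S \<inter> \<Union>(B - {S}) \<subseteq> S \<inter> Sh"
    proof
      fix u assume "u \<in> S \<inter> \<Union>(B - {S})"
      then obtain T where T: "u \<in> S" "T \<in> B" "T \<noteq> S" "u \<in> T"
        by auto
      then have "card {S, T} \<le> deg u"
        unfolding deg_def using assms(1) S by (intro card_mono) auto
      then show "u \<in> S \<inter> Sh"
        using T S by (auto simp: Sh_def U_def)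
    qed
    then have "card (S \<inter> \<Union>(B - {S})) \<le> card (S \<inter> Sh)"
      using assms(2) S by (intro card_mono) auto
    then show ?thesis
      using assms(3)[OF S] by simp
  qed
  then have "(\<Sum>S\<in>B. 2) \<le> (\<Sum>S\<in>B. card (S \<inter> Sh))"
    by (intro sum_mono) auto
  also have "\<dots> = (\<Sum>u\<in>Sh. deg u)"
    unfolding deg_def by (rule sum_card_Int_eq_sum_multiplicity[OF assms(1) fSh])
  also have "\<dots> \<le> (\<Sum>u\<in>Sh. 2 * (deg u - 1))"
    by (intro sum_mono) (auto simp: Sh_def)
  also have "\<dots> \<le> (\<Sum>u\<in>U. 2 * (deg u - 1))"
    using fU by (intro sum_mono2) (auto simp: Sh_def)
  finally have "card B \<le> (\<Sum>u\<in>U. deg u - 1)"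
    by (simp add: sum_distrib_left[symmetric])
  moreover have "(\<Sum>u\<in>U. deg u) = (\<Sum>u\<in>U. (deg u - 1) + 1)"
    by (intro sum.cong refl) (use pos in \<open>fastforce simp: Suc_le_eq\<close>)
  then have "(\<Sum>u\<in>U. deg u) = (\<Sum>u\<in>U. deg u - 1) + card U"
    by (simp only: sum.distrib) simp
  moreover have "(\<Sum>S\<in>B. card S) = (\<Sum>S\<in>B. card (S \<inter> U))"
    by (intro sum.cong refl arg_cong[of _ _ card]) (auto simp: U_def)
  then have "(\<Sum>S\<in>B. card S) = (\<Sum>u\<in>U. deg u)"
    unfolding deg_def using sum_card_Int_eq_sum_multiplicity[OF assms(1) fU] by simp
  ultimately show ?thesis
    by (simp add: U_def)
qed

lemma real_choose_two: "real (n choose 2) = real n * (real n - 1) / 2"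
  by (cases n) (simp_all add: choose_two real_of_nat_div field_simps)

text \<open>In a minimal counterexample every member is rich (hence large) and shares at least two vertices
  with the others, so that the overlaps pay for the term \<^term>\<open>t\<close> in each summand.\<close>

lemma sum_excess_le:
  fixes L t :: int and m :: real
  assumes "1 \<le> L" "real_of_int L \<le> m" "m < real_of_int L + 1" "t \<le> 2 * L - 1"
    and "1 \<le> m - 2 * real_of_int L * (m - real_of_int L)"
    and "\<forall>e\<in>E. card e = 2"
    and dens: "\<And>S. finite S \<Longrightarrow> real (card (induced_edges E S)) \<le> m * real (card S)"
    and single: "\<And>S. finite S \<Longrightarrow> 2 \<le> card S \<Longrightarrow>
      int (card (induced_edges E S)) - L * int (card S) + t \<le> int (card S) - 1"
    and "finite B" "B \<noteq> {}" "\<And>S. S \<in> B \<Longrightarrow> finite S" "\<And>S. S \<in> B \<Longrightarrow> 2 \<le> card S"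
    and "\<And>S T. S \<in> B \<Longrightarrow> T \<in> B \<Longrightarrow> S \<noteq> T \<Longrightarrow> card (S \<inter> T) \<le> 1"
  shows "(\<Sum>S\<in>B. int (card (induced_edges E S)) - L * int (card S) + t) \<le> int (card (\<Union>B)) - 1"
  using assms(9-13)
proof (induction B rule: finite_psubset_induct)
  case (psubset B)
  define x where "x = (\<lambda>S. int (card (induced_edges E S)) - L * int (card S) + t)"
  have fU: "finite (\<Union>B)"
    using psubset by auto
  have sing: "x S \<le> int (card S) - 1" if "S \<in> B" for S
    using single psubset.prems that by (simp add: x_def)
  show ?case
  \<comment> \<open>A member can be split off if its excess is not positive, or if it meets the rest
    in at most one vertex: the two terms \<open>- 1\<close>, from \<open>single\<close> and from the
    induction hypothesis, then cover the shared vertex.\<close>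
  proof (cases "\<exists>S\<in>B. B - {S} = {} \<or> x S \<le> 0 \<or> card (S \<inter> \<Union>(B - {S})) \<le> 1")
    case True
    then obtain S where S: "S \<in> B" "B - {S} = {} \<or> x S \<le> 0 \<or> card (S \<inter> \<Union>(B - {S})) \<le> 1"
      by blast
    show ?thesis
    proof (cases "B - {S} = {}")
      case True
      then have "B = {S}"
        using S by auto
      then show ?thesis
        using sing[of S] by (simp add: x_def)
    next
      case False
      define U' where "U' = \<Union>(B - {S})"
      have "B - {S} \<subset> B"
        using S by auto
      then have IH: "(\<Sum>S\<in>B - {S}. x S) \<le> int (card U') - 1"
        unfolding x_def U'_def by (rule psubset.IH) (use psubset.prems False in auto)
      have sum: "(\<Sum>S\<in>B. x S) = x S + (\<Sum>S\<in>B - {S}. x S)"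
        using psubset.hyps S by (simp add: sum.remove)
      have U: "\<Union>B = S \<union> U'"
        using S by (auto simp: U'_def)
      have fin: "finite S" "finite U'"
        using fU U by auto
      have "x S + (\<Sum>S\<in>B - {S}. x S) \<le> int (card (\<Union>B)) - 1"
      proof (cases "x S \<le> 0")
        case True
        have "card U' \<le> card (\<Union>B)"
          using fU U by (intro card_mono) auto
        then show ?thesis
          using True IH by simp
      next
        case no: False
        then have "card (S \<inter> U') \<le> 1"
          using S(2) False by (simp add: U'_def)
        then show ?thesis
          using sing[OF S(1)] IH card_Un_Int[OF fin] U by simp
      qed
      then show ?thesis
        using sum by (simp add: x_def)
    qed
  next
    case False
    then have ne: "\<And>S. S \<in> B \<Longrightarrow> 0 < x S" "\<And>S. S \<in> B \<Longrightarrow> 2 \<le> card (S \<inter> \<Union>(B - {S}))"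
      by force+
    define N where "N = (\<Sum>S\<in>B. card S)"
    define p where "p = card B"
    define u where "u = card (\<Union>B)"
    have p: "1 \<le> p"
      using psubset.prems(1) psubset.hyps by (simp add: p_def Suc_le_eq card_gt_0_iff)
    have overlap: "u + p \<le> N"
      unfolding N_def p_def u_def
      using psubset.hyps psubset.prems(2) ne(2) by (intro card_Union_overlapping_family) auto
    \<comment> \<open>For a set of size \<open>s\<close>, positive excess,
      \<open>t \<le> 2 * L - 1\<close> and the number of vertex pairs force
      \<open>2 \<le> (s - 2) * (s + 1 - 2 * L)\<close>, so the second factor must be
      positive.\<close>
    have big: "2 * L \<le> int (card S)" if S: "S \<in> B" for S
    proof (rule ccontr)
      assume small: "\<not> 2 * L \<le> int (card S)"
      have "real (card (induced_edges E S)) \<le> real (card S) * (real (card S) - 1) / 2"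
        using card_induced_edges_le_choose[of S E] psubset.prems(2)[OF S] assms(6)
        by (metis of_nat_le_iff real_choose_two)
      moreover have "real_of_int 1 \<le> real_of_int (x S)"
        using ne(1)[OF S] by (subst of_int_le_iff) simp
      moreover have "real_of_int t \<le> 2 * real_of_int L - 1"
        using assms(4) by linarith
      ultimately have "2 \<le> (real (card S) - 2) * (real (card S) + 1 - 2 * real_of_int L)"
        by (simp add: x_def algebra_simps)
      moreover have "(real (card S) - 2) * (real (card S) + 1 - 2 * real_of_int L) \<le> 0"
        using small psubset.prems(3)[OF S] by (intro mult_nonneg_nonpos) linarith+
      ultimately show False
        by simp
    qed
    have "(\<Sum>S\<in>B. 2 * L) \<le> (\<Sum>S\<in>B. int (card S))"
      by (rule sum_mono) (rule big)
    then have "int p * (2 * L) \<le> int N"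
      by (simp add: p_def N_def)
    then have N: "real p * (2 * real_of_int L) \<le> real N"
      by (metis (mono_tags) of_int_le_iff of_int_mult of_int_numeral of_int_of_nat_eq)
    have "(\<Sum>S\<in>B. card (induced_edges E S)) = card (\<Union>S\<in>B. induced_edges E S)"
      using psubset assms(6) by (intro card_Union_induced_edges[symmetric]) auto
    also have "\<dots> \<le> card (induced_edges E (\<Union>B))"
      using fU by (intro card_mono) (auto simp: induced_edges_def)
    finally have "real (\<Sum>S\<in>B. card (induced_edges E S)) \<le> m * real u"
      using dens[OF fU] unfolding u_def by linarith
    moreover have "(\<Sum>S\<in>B. x S) = int (\<Sum>S\<in>B. card (induced_edges E S)) - L * int N + int p * t"
      by (simp add: x_def N_def p_def sum.distrib sum_subtractf sum_distrib_left)
    then have "real_of_int (\<Sum>S\<in>B. x S) =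
        real (\<Sum>S\<in>B. card (induced_edges E S)) - real_of_int L * real N + real p * real_of_int t"
      by simp
    \<comment> \<open>The total excess is at most \<open>m * u - L * N + p * t\<close>. Here
      \<open>(m - 1) * u\<close> is bounded through \<open>u + p \<le> N\<close>, and the remaining
      \<open>- (L + 1 - m) * N\<close> through \<open>2 * L * p \<le> N\<close>. The assumption
      relating \<open>m\<close> and \<open>L\<close> then leaves at most
      \<open>u - p\<close>.\<close>
    moreover have "(m - 1) * real u \<le> (m - 1) * (real N - real p)"
      using overlap assms(1,2) by (intro mult_left_mono) linarith+
    moreover have "(real_of_int L + 1 - m) * (real p * (2 * real_of_int L)) \<le> (real_of_int L + 1 - m) * real N"
      using N assms(3) by (intro mult_left_mono) auto
    moreover have "real p * (real_of_int t + 1) \<le>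
        real p * (2 * real_of_int L - 1 + (m - 2 * real_of_int L * (m - real_of_int L)))"
      using assms(4,5) by (intro mult_left_mono) linarith+
    moreover have "1 \<le> real p"
      using p by simp
    ultimately have "real_of_int (\<Sum>S\<in>B. x S) \<le> real u - 1"
      by (simp add: algebra_simps)
    then have "(\<Sum>S\<in>B. x S) \<le> int u - 1"
      by linarith
    then show ?thesis
      by (simp add: x_def u_def)
  qed
qed

text \<open>\<open>v * v / 4 - 1\<close> factors as \<open>(v - 2) * (v + 2) / 4\<close>, and
  \<open>v - 2\<close> cancels.\<close>

lemma four_mult_le_if_bipartite_density:
  fixes m :: real and v e :: nat
  assumes "3 \<le> v" "4 * e \<le> v\<^sup>2" "m * (real v - 2) \<le> real e - 1"
  shows "4 * m \<le> real v + 2"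
proof -
  have "4 * real e \<le> real v * real v"
    using assms(2) by (metis of_nat_le_iff of_nat_mult of_nat_numeral power2_eq_square)
  then have "4 * m * (real v - 2) \<le> (real v + 2) * (real v - 2)"
    using assms(3) by (simp add: algebra_simps)
  then show ?thesis
    using assms(1) by (simp add: mult_le_cancel_right)
qed

text \<open>The distance of \<open>t\<close> from \<open>2 * L\<close> limits the fractional part of
  \<open>m\<close>. The third bound serves single sets of at least \<open>2 * L + 2\<close>
  vertices; the fourth supplies, when \<open>t\<close> exceeds \<open>L\<close>, the assumption of
  \<open>sum_excess_le\<close> that relates \<open>m\<close> and \<open>L\<close>.\<close>

lemma forest_plus_sparse_arith:
  fixes m :: real and L t :: int and v e :: nat
  assumes "1 \<le> m" "L = \<lfloor>m\<rfloor>" "4 \<le> v" "4 * e \<le> v\<^sup>2"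
    and "m * (real v - 2) \<le> real e - 1" "real_of_int L * (real v - 2) < real e - 1"
    and "t = max 0 (L * int v - int e + 1)"
  shows "1 \<le> L" "t \<le> 2 * L - 1"
    "0 < t \<Longrightarrow> (m - real_of_int L) * (2 * real_of_int L + 2) \<le> 2 * real_of_int L - real_of_int t + 1"
    "0 < t \<Longrightarrow> 2 * real_of_int L * (m - real_of_int L) \<le> 2 * real_of_int L - real_of_int t"
proof -
  define eps where "eps = m - real_of_int L"
  have eps: "0 \<le> eps" "eps < 1"
    using assms(2) unfolding eps_def by linarith+
  show L: "1 \<le> L"
    using assms(1,2) by simp
  have "real_of_int (L * (int v - 2)) < real_of_int (int e - 1)"
    using assms(6) by simp
  then have "L * (int v - 2) < int e - 1"
    by (simp only: of_int_less_iff)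
  then show "t \<le> 2 * L - 1"
    using assms(7) L by (auto simp: algebra_simps)
  have v: "4 * m \<le> real v + 2"
    using assms(3-5) by (intro four_mult_le_if_bipartite_density) auto
  have mv: "m = real_of_int L + eps"
    by (simp add: eps_def)
  \<comment> \<open>For \<open>L \<ge> 2\<close>, \<open>4 * L \<le> v + 2\<close> gives
    \<open>2 * L \<le> 4 * L - 4 \<le> v - 2\<close>; for \<open>L = 1\<close> this is the
    assumption \<open>4 \<le> v\<close>.\<close>
  have v2: "2 * real_of_int L \<le> real v - 2"
  proof (cases "L = 1")
    case False
    then have "2 \<le> real_of_int L"
      using L by linarith
    then show ?thesis
      using v mv eps by linarith
  qed (use assms(3) in simp)
  {
    assume t: "0 < t"
    then have "real_of_int t = real_of_int L * real v - real e + 1"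
      using assms(7) by (simp add: max_def split: if_splits)
    \<comment> \<open>\<open>2 * L - t = (e - 1) - L * (v - 2)\<close> for positive
      \<open>t\<close>, so this is the density assumption with \<open>m = L + eps\<close>.\<close>
    then have main: "eps * (real v - 2) \<le> 2 * real_of_int L - real_of_int t"
      using assms(5) by (simp add: mv algebra_simps)
    have "eps * (2 * real_of_int L) \<le> eps * (real v - 2)"
      using v2 eps by (intro mult_left_mono) auto
    then show half: "2 * real_of_int L * (m - real_of_int L) \<le> 2 * real_of_int L - real_of_int t"
      using main by (simp add: eps_def algebra_simps)
    have "eps * (2 * real_of_int L + 2) \<le> 2 * real_of_int L - real_of_int t + 1"
    proof (cases "2 * real_of_int L + 1 \<le> real v - 2")
      case True
      then have "eps * (2 * real_of_int L + 1) \<le> eps * (real v - 2)"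
        using eps by (intro mult_left_mono) auto
      then show ?thesis
        using main eps by (simp add: algebra_simps)
    next
      \<comment> \<open>Only \<open>v \<le> 2 * L + 2\<close> remains, where
        \<open>4 * m \<le> v + 2\<close> gives \<open>2 * eps \<le> 2 - L \<le> 1\<close>.\<close>
      case False
      then have "int v < 2 * L + 3"
        by linarith
      then have "real v \<le> 2 * real_of_int L + 2"
        by linarith
      then have "2 * eps \<le> 1"
        using v mv L by linarith
      then show ?thesis
        using half by (simp add: eps_def algebra_simps)
    qed
    then show "(m - real_of_int L) * (2 * real_of_int L + 2) \<le> 2 * real_of_int L - real_of_int t + 1"
      by (simp add: eps_def)
  }
qed

text \<open>The strict inequality for the rounded-down \<open>m\<close> is what keeps
  \<open>t\<close> below \<open>2 * L\<close>, so that a single edge is still sparse.\<close>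

theorem partition_forest_plus_sparse:
  fixes m :: real and v e :: nat
  assumes "finite V" "E \<subseteq> Pow V" "\<forall>e\<in>E. card e = 2"
    and dens: "\<And>S. S \<subseteq> V \<Longrightarrow> real (card (induced_edges E S)) \<le> m * real (card S)"
    and "1 \<le> m" "4 \<le> v" "4 * e \<le> v\<^sup>2"
    and "m * (real v - 2) \<le> real e - 1" "real_of_int \<lfloor>m\<rfloor> * (real v - 2) < real e - 1"
  obtains F R where "F \<union> R = E" "F \<inter> R = {}" "sparse 1 1 F"
    "\<And>S. finite S \<Longrightarrow> card S = v \<Longrightarrow> card (induced_edges R S) < e"
proof -
  define L where "L = \<lfloor>m\<rfloor>"
  define t where "t = max 0 (L * int v - int e + 1)"
  note ar = forest_plus_sparse_arith[OF assms(5) L_def assms(6-8) assms(9)[folded L_def] t_def]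
  have m: "real_of_int L \<le> m" "m < real_of_int L + 1"
    unfolding L_def by linarith+
  have dens': "real (card (induced_edges E S)) \<le> m * real (card S)" if "finite S" for S
  proof -
    have "induced_edges E S = induced_edges E (S \<inter> V)"
      using assms(2) by (auto simp: induced_edges_def)
    then have "real (card (induced_edges E S)) \<le> m * real (card (S \<inter> V))"
      using dens[of "S \<inter> V"] by simp
    also have "\<dots> \<le> m * real (card S)"
      using that assms(5) by (intro mult_left_mono) (auto intro: card_mono)
    finally show ?thesis .
  qed
  \<comment> \<open>A set may exceed \<open>L * n - t\<close> by no more than a spanning tree has
    edges. Up to \<open>2 * L + 1\<close> vertices the number of pairs suffices. Beyond that,
    positive \<open>t\<close> needs the bound on the fractional part of \<open>m\<close>; for
    \<open>t = 0\<close>, integrality turns \<open>m < L + 1\<close> into a gain of one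
    edge.\<close>
  have single: "int (card (induced_edges E S)) - L * int (card S) + t \<le> int (card S) - 1"
    if S: "finite S" "2 \<le> card S" for S
  proof -
    define n where "n = card S"
    have choose: "real (card (induced_edges E S)) \<le> real n * (real n - 1) / 2"
      using card_induced_edges_le_choose[of S E] S assms(3) unfolding n_def
      by (metis of_nat_le_iff real_choose_two)
    have tL: "real_of_int t \<le> 2 * real_of_int L - 1"
      using ar(2) by linarith
    have "real (card (induced_edges E S)) - real_of_int L * real n + real_of_int t \<le> real n - 1"
      if "int n \<le> 2 * L + 1"
    proof -
      have "0 \<le> (real n - 2) * (2 * real_of_int L + 1 - real n)"
        using that S unfolding n_def by (intro mult_nonneg_nonneg) linarith+
      then show ?thesis
        using choose tL by (simp add: algebra_simps)
    qed
    moreover have "real (card (induced_edges E S)) - real_of_int L * real n + real_of_int t \<le> real n - 1"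
      if n: "2 * L + 2 \<le> int n" "0 < t"
    proof -
      have "2 * real_of_int L + 2 \<le> real n"
        using n by linarith
      then have "(real_of_int L + 1 - m) * (2 * real_of_int L + 2) \<le> (real_of_int L + 1 - m) * real n"
        using m by (intro mult_left_mono) auto
      then show ?thesis
        using ar(3)[OF n(2)] dens'[OF S(1)] by (simp add: algebra_simps n_def)
    qed
    moreover have "real (card (induced_edges E S)) - real_of_int L * real n + real_of_int t \<le> real n - 1"
      if t: "\<not> 0 < t"
    proof -
      have "t = 0"
        using t by (simp add: t_def)
      have "m * real n < (real_of_int L + 1) * real n"
        using m S by (intro mult_strict_right_mono) (auto simp: n_def)
      then have "real (card (induced_edges E S)) < (real_of_int L + 1) * real n"
        using dens'[OF S(1)] by (simp add: n_def)
      then have "real_of_int (int (card (induced_edges E S))) < real_of_int ((L + 1) * int n)"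
        by simp
      then have "int (card (induced_edges E S)) < (L + 1) * int n"
        by (simp only: of_int_less_iff)
      then have "int (card (induced_edges E S)) - L * int n + t \<le> int n - 1"
        using \<open>t = 0\<close> by (simp add: algebra_simps)
      then have "real_of_int (int (card (induced_edges E S)) - L * int n + t) \<le> real_of_int (int n - 1)"
        by (simp only: of_int_le_iff)
      then show ?thesis
        by simp
    qed
    ultimately have "real (card (induced_edges E S)) - real_of_int L * real n + real_of_int t \<le> real n - 1"
      by linarith
    then have "real_of_int (int (card (induced_edges E S)) - L * int n + t) \<le> real_of_int (int n - 1)"
      by simp
    then show ?thesis
      unfolding n_def by (simp only: of_int_le_iff)
  qed
  obtain F R where FR: "F \<union> R = E" "F \<inter> R = {}" "sparse 1 1 F" "sparse L t R"
  proof (rule partition_into_two_sparse[OF assms(1-3), of 1 1 L t])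
    fix W B
    assume W: "W \<subseteq> V" "2 \<le> card W" and B: "finite B" "B \<subseteq> Pow W" "\<And>S. S \<in> B \<Longrightarrow> 2 \<le> card S"
      "\<And>S T. S \<in> B \<Longrightarrow> T \<in> B \<Longrightarrow> S \<noteq> T \<Longrightarrow> card (S \<inter> T) \<le> 1"
      "\<And>S T. S \<in> B \<Longrightarrow> T \<in> B \<Longrightarrow> S \<noteq> T \<Longrightarrow> t \<le> L \<Longrightarrow> S \<inter> T = {}"
    have fW: "finite W"
      using W assms(1) finite_subset by blast
    have fS: "finite S" if "S \<in> B" for S
      using that B(2) fW by (meson PowD finite_subset subsetD)
    have "card (\<Union>B) \<le> card W"
      using B(2) fW by (intro card_mono) auto
    moreover have "(\<Sum>S\<in>B. int (card (induced_edges E S)) - L * int (card S) + t) \<le> int (card (\<Union>B)) - 1"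
      if "B \<noteq> {}"
    \<comment> \<open>For \<open>t \<le> L\<close> the blocks are disjoint and the bounds on single
      sets add up; otherwise blocks may overlap and \<open>sum_excess_le\<close> is needed.\<close>
    proof (cases "t \<le> L")
      case True
      have "(\<Sum>S\<in>B. int (card (induced_edges E S)) - L * int (card S) + t) \<le> (\<Sum>S\<in>B. int (card S) - 1)"
        using fS B(3) by (intro sum_mono single)
      also have "\<dots> = int (\<Sum>S\<in>B. card S) - int (card B)"
        by (simp add: sum_subtractf)
      also have "(\<Sum>S\<in>B. card S) = card (\<Union>B)"
        using card_UN_disjoint[of B "\<lambda>S. S"] B(1,5) True fS by simp
      also have "int (card (\<Union>B)) - int (card B) \<le> int (card (\<Union>B)) - 1"
        using that B(1) by (simp add: Suc_le_eq card_gt_0_iff)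
      finally show ?thesis .
    next
      case False
      then have "0 < t" "real_of_int L + 1 \<le> real_of_int t"
        using ar(1) by linarith+
      then have "1 \<le> m - 2 * real_of_int L * (m - real_of_int L)"
        using ar(4) m by linarith
      then show ?thesis
        using ar(1,2) m assms(3) dens' single B(1,3,4) fS that by (intro sum_excess_le) auto
    qed
    moreover have "(\<Sum>S\<in>B. int (card (induced_edges E S)) - L * int (card S) + t)
        = (\<Sum>S\<in>B. int (card (induced_edges E S))) - (\<Sum>S\<in>B. L * int (card S) - t)"
      by (simp add: sum_subtractf sum.distrib)
    ultimately show "(\<Sum>S\<in>B. int (card (induced_edges E S)))
        \<le> 1 * int (card W) - 1 + (\<Sum>S\<in>B. L * int (card S) - t)"
      using W(2) by (cases "B = {}") auto
  next
    show "0 \<le> t" "t \<le> 2 * L" "0 \<le> L"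
      using ar(1,2) by (auto simp: t_def)
  qed (use that in auto)
  have "card (induced_edges R S) < e" if "finite S" "card S = v" for S
  proof -
    have "int (card (induced_edges R S)) \<le> L * int v - t"
      using FR(4) that assms(6) unfolding sparse_def by auto
    then show ?thesis
      unfolding t_def by linarith
  qed
  then show ?thesis
    using that FR by blast
qed

section \<open>Degeneracy, copies and densities\<close>

definition nbrs :: "'a set set \<Rightarrow> 'a set \<Rightarrow> 'a \<Rightarrow> 'a set" where
  "nbrs E S v = {u \<in> S. {u, v} \<in> E}"

lemma fin_graph_edges:
  assumes "fin_graph G"
  shows "finite (verts G)" "edges G \<subseteq> Pow (verts G)" "\<forall>e\<in>edges G. card e = 2" "finite (edges G)"
proof -
  show *: "finite (verts G)" "edges G \<subseteq> Pow (verts G)" "\<forall>e\<in>edges G. card e = 2"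
    using assms by (auto simp: fin_graph_def)
  show "finite (edges G)"
    using *(1,2) finite_subset by blast
qed

lemma induced_edges_verts:
  "fin_graph G \<Longrightarrow> induced_edges (edges G) (verts G) = edges G"
  by (auto simp: fin_graph_def induced_edges_def)

lemma card_nbrs_eq_card_incident:
  assumes "\<forall>e\<in>E. card e = 2" "v \<in> S"
  shows "card (nbrs E S v) = card {e \<in> induced_edges E S. v \<in> e}"
proof -
  have "bij_betw (\<lambda>u. {u, v}) (nbrs E S v) {e \<in> induced_edges E S. v \<in> e}"
    unfolding bij_betw_def
  proof
    have "u \<noteq> v" if "u \<in> nbrs E S v" for u
      using that assms(1) by (auto simp: nbrs_def)
    then show "inj_on (\<lambda>u. {u, v}) (nbrs E S v)"
      by (auto simp: inj_on_def doubleton_eq_iff)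
    show "(\<lambda>u. {u, v}) ` nbrs E S v = {e \<in> induced_edges E S. v \<in> e}"
    proof (intro set_eqI iffI)
      fix e assume e: "e \<in> {e \<in> induced_edges E S. v \<in> e}"
      then have "card e = 2"
        using assms(1) by (auto simp: induced_edges_def)
      then obtain u where "e = {u, v}"
        using e by (auto simp: card_2_iff)
      then show "e \<in> (\<lambda>u. {u, v}) ` nbrs E S v"
        using e by (auto simp: nbrs_def induced_edges_def)
    qed (use assms(2) in \<open>auto simp: nbrs_def induced_edges_def\<close>)
  qed
  then show ?thesis
    by (rule bij_betw_same_card)
qed

lemma sum_card_nbrs:
  assumes "\<forall>e\<in>E. card e = 2" "finite S"
  shows "(\<Sum>v\<in>S. card (nbrs E S v)) = 2 * card (induced_edges E S)"
proof -
  have "(\<Sum>v\<in>S. card (nbrs E S v)) = (\<Sum>v\<in>S. card {e \<in> induced_edges E S. v \<in> e})"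
    using card_nbrs_eq_card_incident[OF assms(1)] by simp
  also have "\<dots> = (\<Sum>e\<in>induced_edges E S. card (e \<inter> S))"
    using assms(2) by (intro sum_card_Int_eq_sum_multiplicity[symmetric]) auto
  also have "\<dots> = (\<Sum>e\<in>induced_edges E S. 2)"
    using assms(1) by (intro sum.cong refl) (auto simp: induced_edges_def Int_absorb2)
  finally show ?thesis
    by simp
qed

lemma low_degree_vertex:
  fixes m :: real
  assumes "\<forall>e\<in>E. card e = 2" "finite S" "S \<noteq> {}" "real (card (induced_edges E S)) \<le> m * real (card S)"
  obtains v where "v \<in> S" "real (card (nbrs E S v)) \<le> 2 * m"
proof (rule ccontr)
  assume "\<not> thesis"
  then have "\<And>v. v \<in> S \<Longrightarrow> 2 * m < real (card (nbrs E S v))"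
    using that by fastforce
  then have "(\<Sum>v\<in>S. 2 * m) < (\<Sum>v\<in>S. real (card (nbrs E S v)))"
    using assms(2,3) by (intro sum_strict_mono) auto
  also have "\<dots> = real (2 * card (induced_edges E S))"
    unfolding sum_card_nbrs[OF assms(1,2), symmetric] by simp
  finally show False
    using assms(4) by (simp add: mult.commute)
qed

text \<open>A vertex with fewer than \<^term>\<open>q * d\<close> neighbours among its predecessors
  has fewer than \<^term>\<open>d\<close> in one of the \<^term>\<open>q\<close> classes.\<close>

lemma vertex_partition_degenerate:
  fixes m :: real and q d :: nat
  assumes "\<forall>e\<in>E. card e = 2" "finite V" "2 * m < real (q * d)"
    and "\<And>S. S \<subseteq> V \<Longrightarrow> real (card (induced_edges E S)) \<le> m * real (card S)"
  obtains f :: "'a \<Rightarrow> nat" where "\<forall>v\<in>V. f v < q"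
    "\<And>S. S \<subseteq> V \<Longrightarrow> S \<noteq> {} \<Longrightarrow> \<exists>v\<in>S. card {u \<in> nbrs E S v. f u = f v} < d"
proof -
  have "\<exists>f::'a \<Rightarrow> nat. (\<forall>v\<in>V. f v < q) \<and>
      (\<forall>S\<subseteq>V. S \<noteq> {} \<longrightarrow> (\<exists>v\<in>S. card {u \<in> nbrs E S v. f u = f v} < d))"
    using assms(2,4)
  proof (induction V rule: finite_psubset_induct)
    case (psubset V)
    show ?case
    proof (cases "V = {}")
      case False
      then obtain v where v: "v \<in> V" "real (card (nbrs E V v)) \<le> 2 * m"
        using low_degree_vertex[OF assms(1) psubset.hyps False psubset.prems[OF order_refl]] by blast
      have "V - {v} \<subset> V"
        using v by auto
      then obtain g where g: "\<forall>u\<in>V - {v}. g u < q"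
        "\<forall>S\<subseteq>V - {v}. S \<noteq> {} \<longrightarrow> (\<exists>w\<in>S. card {u \<in> nbrs E S w. g u = g w} < d)"
        using psubset.IH[of "V - {v}"] psubset.prems by blast
      \<comment> \<open>Without a loop, \<open>v\<close> is not listed among its own neighbours, so
        \<open>f\<close> and \<open>g\<close> agree on them.\<close>
      have vE: "{v} \<notin> E"
        using assms(1) by fastforce
      have fN: "finite (nbrs E V v)"
        using psubset.hyps by (simp add: nbrs_def)
      have "\<exists>i<q. card {u \<in> nbrs E V v. g u = i} < d"
      proof (rule ccontr)
        assume "\<not> ?thesis"
        then have "(\<Sum>i<q. d) \<le> (\<Sum>i<q. card {u \<in> nbrs E V v. g u = i})"
          by (intro sum_mono) (meson lessThan_iff not_le_imp_less)
        also have "\<dots> = card (\<Union>i<q. {u \<in> nbrs E V v. g u = i})"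
          using fN by (intro card_UN_disjoint[symmetric]) auto
        also have "\<dots> \<le> card (nbrs E V v)"
          using fN by (intro card_mono) auto
        finally have "real (q * d) \<le> real (card (nbrs E V v))"
          by (simp only: sum_constant card_lessThan of_nat_le_iff of_nat_id)
        then show False
          using v(2) assms(3) by simp
      qed
      then obtain i where i: "i < q" "card {u \<in> nbrs E V v. g u = i} < d"
        by blast
      define f where "f = g(v := i)"
      have "\<exists>w\<in>S. card {u \<in> nbrs E S w. f u = f w} < d" if S: "S \<subseteq> V" "S \<noteq> {}" for S
      proof (cases "v \<in> S")
        case True
        have "{u \<in> nbrs E S v. f u = f v} \<subseteq> {u \<in> nbrs E V v. g u = i}"
          using S vE by (auto simp: f_def nbrs_def split: if_splits)
        then have "card {u \<in> nbrs E S v. f u = f v} \<le> card {u \<in> nbrs E V v. g u = i}"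
          using fN by (intro card_mono) auto
        then show ?thesis
          using True i(2) by (intro bexI[of _ v]) auto
      next
        case False
        then have "S \<subseteq> V - {v}"
          using S(1) by auto
        then obtain w where w: "w \<in> S" "card {u \<in> nbrs E S w. g u = g w} < d"
          using g(2) S(2) by blast
        have "{u \<in> nbrs E S w. f u = f w} = {u \<in> nbrs E S w. g u = g w}"
          using False w(1) by (auto simp: f_def nbrs_def)
        with w(2) have "card {u \<in> nbrs E S w. f u = f w} < d"
          by (simp only:)
        then show ?thesis
          using w(1) by blast
      qed
      moreover have "\<forall>u\<in>V. f u < q"
        using g(1) i(1) by (auto simp: f_def)
      ultimately show ?thesis
        by blast
    qed auto
  qed
  then show ?thesis
    using that by blast
qed

section \<open>Copies in sparse and in degenerate edge sets\<close>

lemma isomorphic_card_eq: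
  assumes "isomorphic J H" "fin_graph J"
  shows "vn J = vn H" "en J = en H"
proof -
  obtain f where f: "bij_betw f (verts J) (verts H)" "edges H = (\<lambda>e. f ` e) ` edges J"
    using assms(1) by (auto simp: isomorphic_def)
  show "vn J = vn H"
    using f(1) by (simp add: vn_def bij_betw_same_card)
  have "inj_on (\<lambda>e. f ` e) (edges J)"
    using f(1) fin_graph_edges(2)[OF assms(2)]
    by (meson bij_betw_imp_inj_on inj_on_image_Pow inj_on_subset)
  then show "en J = en H"
    using f(2) by (simp add: en_def card_image)
qed

text \<open>No copy of \<open>K\<close> inside \<open>J\<close> has to be built: the preimage of its
  vertices spans enough edges, and sparsity only sees counts.\<close>

lemma isomorphic_subgraph_preimage:
  assumes "isomorphic J H" "fin_graph J" "subgraph K H"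
  obtains S where "S \<subseteq> verts J" "card S = vn K" "en K \<le> card (induced_edges (edges J) S)"
proof -
  obtain f where f: "bij_betw f (verts J) (verts H)" "edges H = (\<lambda>e. f ` e) ` edges J"
    using assms(1) by (auto simp: isomorphic_def)
  have inj: "inj_on f (verts J)"
    using f(1) by (rule bij_betw_imp_inj_on)
  define S where "S = {u \<in> verts J. f u \<in> verts K}"
  have K: "verts K \<subseteq> verts H" "edges K \<subseteq> edges H" "\<And>e. e \<in> edges K \<Longrightarrow> e \<subseteq> verts K"
    using assms(3) by (auto simp: subgraph_def fin_graph_def)
  have "f ` S = verts K"
    using f(1) K(1) unfolding S_def bij_betw_def by auto
  then have "bij_betw f S (verts K)"
    using inj by (auto simp: bij_betw_def S_def intro: inj_on_subset)
  then have S: "card S = vn K"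
    by (simp add: vn_def bij_betw_same_card)
  have "edges K \<subseteq> (\<lambda>e. f ` e) ` induced_edges (edges J) S"
  proof
    fix e assume e: "e \<in> edges K"
    then obtain e' where e': "e' \<in> edges J" "e = f ` e'"
      using K(2) f(2) by auto
    then have "e' \<subseteq> S"
      using K(3)[OF e] fin_graph_edges(2)[OF assms(2)] by (auto simp: S_def)
    then show "e \<in> (\<lambda>e. f ` e) ` induced_edges (edges J) S"
      using e' by (auto simp: induced_edges_def)
  qed
  moreover have "finite S"
    using fin_graph_edges(1)[OF assms(2)] by (auto simp: S_def)
  ultimately have "en K \<le> card (induced_edges (edges J) S)"
    unfolding en_def by (meson card_image_le card_mono finite_imageI finite_induced_edges le_trans)
  then show ?thesis
    using that[of S] S by (auto simp: S_def)
qed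

lemma no_copy_in_sparse:
  assumes "sparse k t I" "edges J \<subseteq> I" "isomorphic J H" "fin_graph J"
    and "subgraph K H" "2 \<le> vn K" "k * int (vn K) - t < int (en K)"
  shows False
proof -
  obtain S where S: "S \<subseteq> verts J" "card S = vn K" "en K \<le> card (induced_edges (edges J) S)"
    using isomorphic_subgraph_preimage[OF assms(3-5)] .
  have fS: "finite S"
    using S(1) fin_graph_edges(1)[OF assms(4)] finite_subset by blast
  have "card (induced_edges (edges J) S) \<le> card (induced_edges I S)"
    using assms(2) fS by (intro card_mono induced_edges_mono) auto
  then show False
    using assms(1,6,7) S fS unfolding sparse_def by fastforce
qed

text \<open>On the vertex set of a copy every vertex would have at least \<open>d\<close> neighbours
  in \<open>I\<close>.\<close>

lemma no_copy_in_degenerate: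
  assumes "\<And>S. S \<subseteq> V \<Longrightarrow> S \<noteq> {} \<Longrightarrow> \<exists>v\<in>S. card (nbrs I S v) < d"
    and "edges J \<subseteq> I" "verts J \<subseteq> V" "isomorphic J H" "fin_graph J" "verts H \<noteq> {}"
    and "\<And>v. v \<in> verts H \<Longrightarrow> d \<le> card (nbrs (edges H) (verts H) v)"
  shows False
proof -
  obtain f where f: "bij_betw f (verts J) (verts H)" "edges H = (\<lambda>e. f ` e) ` edges J"
    using assms(4) by (auto simp: isomorphic_def)
  have inj: "inj_on f (verts J)" and img: "f ` verts J = verts H"
    using f(1) by (auto simp: bij_betw_def)
  have fJ: "finite (verts J)"
    using fin_graph_edges(1)[OF assms(5)] .
  have "verts J \<noteq> {}"
    using img assms(6) by auto
  then obtain v where v: "v \<in> verts J" "card (nbrs I (verts J) v) < d"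
    using assms(1,3) by blast
  have "nbrs (edges H) (verts H) (f v) \<subseteq> f ` nbrs I (verts J) v"
  proof
    fix w assume w: "w \<in> nbrs (edges H) (verts H) (f v)"
    then obtain u where u: "u \<in> verts J" "w = f u"
      using img by (auto simp: nbrs_def)
    then obtain e where e: "e \<in> edges J" "{f u, f v} = f ` e"
      using w f(2) by (auto simp: nbrs_def)
    then have "f ` {u, v} = f ` e"
      by simp
    then have "{u, v} = e"
      using inj_on_image_eq_iff[OF inj, of "{u, v}" e] u v e fin_graph_edges(2)[OF assms(5)] by auto
    then show "w \<in> f ` nbrs I (verts J) v"
      using u e assms(2) by (auto simp: nbrs_def)
  qed
  then have "card (nbrs (edges H) (verts H) (f v)) \<le> card (f ` nbrs I (verts J) v)"
    using fJ by (intro card_mono) (auto simp: nbrs_def)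
  also have "\<dots> \<le> card (nbrs I (verts J) v)"
    using fJ by (intro card_image_le) (simp add: nbrs_def)
  finally show False
    using v assms(7)[of "f v"] img by auto
qed

lemma colourable_isomorphic:
  assumes "isomorphic J H" "fin_graph J" "colourable J k"
  shows "colourable H k"
proof -
  obtain f where f: "bij_betw f (verts J) (verts H)" "edges H = (\<lambda>e. f ` e) ` edges J"
    using assms(1) by (auto simp: isomorphic_def)
  have inj: "inj_on f (verts J)" and img: "f ` verts J = verts H"
    using f(1) by (auto simp: bij_betw_def)
  obtain c :: "'a \<Rightarrow> nat" where c: "\<forall>v\<in>verts J. c v < k" "\<forall>u v. {u, v} \<in> edges J \<longrightarrow> c u \<noteq> c v"
    using assms(3) by (auto simp: colourable_def)
  define c' where "c' = (\<lambda>w. c (inv_into (verts J) f w))"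
  have c': "c' (f u) = c u" if "u \<in> verts J" for u
    using inj that by (simp add: c'_def)
  have "c' a \<noteq> c' b" if ab: "{a, b} \<in> edges H" for a b
  proof -
    obtain e where e: "e \<in> edges J" "{a, b} = f ` e"
      using ab f(2) by auto
    have eJ: "e \<subseteq> verts J" "card e = 2"
      using e assms(2) by (auto simp: fin_graph_def)
    obtain u v where uv: "u \<in> e" "a = f u" "v \<in> e" "b = f v"
      using e(2) by blast
    have "card {a, b} = 2"
      using e(2) eJ card_image[of f e] inj by (metis inj_on_subset)
    then have "u \<noteq> v"
      using uv by auto
    then have "e = {u, v}"
      using eJ(2) uv by (auto simp: card_2_iff)
    then show ?thesis
      using c(2) e(1) c' uv eJ by (metis subsetD)
  qed
  moreover have "\<forall>w\<in>verts H. c' w < k"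
    unfolding img[symmetric] using c(1) c' by simp
  ultimately show ?thesis
    unfolding colourable_def by blast
qed

lemma colourable_cross_edges:
  assumes "subgraph J G" "edges J \<subseteq> {e \<in> edges G. \<exists>u v. e = {u, v} \<and> f u \<noteq> f v}" "\<forall>v\<in>verts G. f v < k"
  shows "colourable J k"
  unfolding colourable_def
proof (intro exI[of _ f] conjI allI impI ballI)
  fix u v assume "{u, v} \<in> edges J"
  then obtain a b where "{u, v} = {a, b}" "f a \<noteq> f b"
    using assms(2) by blast
  then show "f u \<noteq> f v"
    by (auto simp: doubleton_eq_iff)
qed (use assms(1,3) in \<open>auto simp: subgraph_def\<close>)

lemma not_arrows_if_partition:
  assumes "\<And>J. subgraph J G \<Longrightarrow> isomorphic J H1 \<Longrightarrow> edges J \<subseteq> R \<Longrightarrow> False"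
    and "\<And>J. subgraph J G \<Longrightarrow> isomorphic J H2 \<Longrightarrow> edges J \<subseteq> edges G - R \<Longrightarrow> False"
  shows "\<not> arrows G H1 H2"
proof
  assume arr: "arrows G H1 H2"
  define c where "c = (\<lambda>e. if e \<in> R then 1 else 2 :: nat)"
  have "mono_copy G c 1 H1 \<or> mono_copy G c 2 H2"
    using arr by (auto simp: arrows_def c_def)
  then show False
  proof
    assume "mono_copy G c 1 H1"
    then obtain J where J: "subgraph J G" "isomorphic J H1" "\<forall>e\<in>edges J. c e = 1"
      by (auto simp: mono_copy_def)
    then have "edges J \<subseteq> R"
      by (auto simp: c_def split: if_splits)
    then show False
      using assms(1) J by blast
  next
    assume "mono_copy G c 2 H2"
    then obtain J where J: "subgraph J G" "isomorphic J H2" "\<forall>e\<in>edges J. c e = 2"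
      by (auto simp: mono_copy_def)
    then have "edges J \<subseteq> edges G - R"
      by (auto simp: c_def subgraph_def split: if_splits)
    then show False
      using assms(2) J by blast
  qed
qed

section \<open>Densities of strictly balanced graphs\<close>

lemma subgraph_refl: "fin_graph H \<Longrightarrow> subgraph H H"
  by (simp add: subgraph_def)

lemma Max_dens_ge:
  fixes d :: "'a ugraph \<Rightarrow> real"
  assumes "fin_graph H" "subgraph J H"
  shows "d J \<le> Max (d ` {J. subgraph J H})"
  using finite_subgraphs[OF assms(1)] assms(2) by (intro Max_ge) auto

lemma Max_dens_witness:
  fixes d :: "'a ugraph \<Rightarrow> real"
  assumes "fin_graph H"
  obtains J where "subgraph J H" "d J = Max (d ` {J. subgraph J H})"
proof -
  have "Max (d ` {J. subgraph J H}) \<in> d ` {J. subgraph J H}"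
    using finite_subgraphs[OF assms] by (intro Max_in) auto
  then show ?thesis
    using that by auto
qed

lemma card_induced_edges_le_m_dens:
  assumes "fin_graph G" "m_dens G \<le> m" "S \<subseteq> verts G"
  shows "real (card (induced_edges (edges G) S)) \<le> m * real (card S)"
proof (cases "S = {}")
  case True
  then have "induced_edges (edges G) S = {}"
    using assms(1) by (auto simp: induced_edges_def fin_graph_def)
  then show ?thesis
    using True by simp
next
  case False
  have fS: "finite S"
    using assms(1,3) fin_graph_edges(1) finite_subset by blast
  have "subgraph (S, induced_edges (edges G) S) G"
    using assms(1,3) fS by (auto simp: subgraph_def fin_graph_def induced_edges_def)
  then have "d_dens (S, induced_edges (edges G) S) \<le> m"
    using Max_dens_ge[OF assms(1), of _ d_dens] assms(2) unfolding m_dens_def by fastforce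
  moreover have "1 \<le> card S"
    using False fS by (simp add: Suc_le_eq card_gt_0_iff)
  ultimately show ?thesis
    by (simp add: d_dens_def vn_def en_def field_simps)
qed

lemma en_le_choose:
  assumes "fin_graph H"
  shows "real (en H) \<le> real (vn H) * (real (vn H) - 1) / 2"
proof -
  have "en H \<le> vn H choose 2"
    using card_induced_edges_le_choose[of "verts H" "edges H"] induced_edges_verts[OF assms]
      fin_graph_edges[OF assms] by (simp add: en_def vn_def)
  then show ?thesis
    by (metis of_nat_le_iff real_choose_two)
qed

lemma nonempty_graph_if_en_pos: "0 < en H \<Longrightarrow> nonempty_graph H"
  by (auto simp: nonempty_graph_def en_def)

text \<open>The other two branches of \<open>d2_dens\<close> only give 1/2 and 0.\<close>

lemma d2_dens_gt_1_D:
  assumes "1 < d2_dens H"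
  shows "nonempty_graph H" "3 \<le> vn H" "d2_dens H = (real (en H) - 1) / (real (vn H) - 2)"
  using assms by (auto simp: d2_dens_def split: if_splits)

definition delete_vertex :: "'a ugraph \<Rightarrow> 'a \<Rightarrow> 'a ugraph" where
  "delete_vertex H x = (verts H - {x}, {e \<in> edges H. x \<notin> e})"

lemma delete_vertex:
  assumes "fin_graph H" "x \<in> verts H"
  shows "proper_subgraph (delete_vertex H x) H"
    "real (vn (delete_vertex H x)) = real (vn H) - 1"
    "real (en (delete_vertex H x)) = real (en H) - real (card (nbrs (edges H) (verts H) x))"
proof -
  note G = fin_graph_edges[OF assms(1)]
  have "subgraph (delete_vertex H x) H"
    using assms(1) by (auto simp: subgraph_def delete_vertex_def fin_graph_def)
  moreover have "delete_vertex H x \<noteq> H"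
    using assms(2) by (metis DiffD2 delete_vertex_def fst_conv singletonI)
  ultimately show "proper_subgraph (delete_vertex H x) H"
    by (simp add: proper_subgraph_def)
  have "0 < vn H"
    using assms(2) G(1) by (auto simp: vn_def card_gt_0_iff)
  then show "real (vn (delete_vertex H x)) = real (vn H) - 1"
    using assms(2) by (simp add: vn_def delete_vertex_def card_Diff_singleton)
  have "edges H = {e \<in> edges H. x \<notin> e} \<union> {e \<in> edges H. x \<in> e}"
    by auto
  then have "card (edges H) = card {e \<in> edges H. x \<notin> e} + card {e \<in> edges H. x \<in> e}"
    using G(4) by (metis (no_types, lifting) card_Un_disjoint disjoint_iff finite_Un mem_Collect_eq)
  moreover have "card (nbrs (edges H) (verts H) x) = card {e \<in> edges H. x \<in> e}"
    using card_nbrs_eq_card_incident[OF G(3) assms(2)] induced_edges_verts[OF assms(1)] by simp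
  ultimately show "real (en (delete_vertex H x)) = real (en H) - real (card (nbrs (edges H) (verts H) x))"
    by (simp add: en_def delete_vertex_def)
qed

text \<open>Proper subgraphs stay strictly below the maximum, so \<open>H\<close> itself attains it.
  The last bound compares \<open>H\<close> with a complete graph:
  \<open>v * (v - 1) / 2 - 1 = (v - 2) * (v + 1) / 2\<close>.\<close>

lemma strictly_2_balanced_dens:
  assumes "fin_graph H" "strictly_2_balanced H" "1 < m2_dens H"
  shows "nonempty_graph H" "3 \<le> vn H" "real (en H) - 1 = m2_dens H * (real (vn H) - 2)"
    "vn H \<le> en H" "2 * m2_dens H \<le> real (vn H) + 1"
proof -
  obtain J where J: "subgraph J H" "d2_dens J = m2_dens H"
    using Max_dens_witness[OF assms(1), of d2_dens] unfolding m2_dens_def .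
  then have "J = H"
    using assms(2) unfolding strictly_2_balanced_def proper_subgraph_def by (metis less_irrefl)
  then have d: "d2_dens H = m2_dens H"
    using J by simp
  then have H: "nonempty_graph H" "3 \<le> vn H" "m2_dens H = (real (en H) - 1) / (real (vn H) - 2)"
    using d2_dens_gt_1_D[of H] assms(3) by simp_all
  then show "nonempty_graph H" "3 \<le> vn H" by simp_all
  show eq: "real (en H) - 1 = m2_dens H * (real (vn H) - 2)"
    using H by simp
  have "1 * (real (vn H) - 2) < m2_dens H * (real (vn H) - 2)"
    using assms(3) H(2) by (intro mult_strict_right_mono) auto
  then have "real (vn H) < real (en H + 1)"
    using eq by simp
  then show "vn H \<le> en H"
    by (simp only: of_nat_less_iff)
  have "2 * m2_dens H * (real (vn H) - 2) \<le> (real (vn H) + 1) * (real (vn H) - 2)"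
    using eq en_le_choose[OF assms(1)] by (simp add: algebra_simps)
  then show "2 * m2_dens H \<le> real (vn H) + 1"
    using H(2) by (simp add: mult_le_cancel_right)
qed

lemma complete_if_en_eq_choose:
  assumes "fin_graph H" "en H = vn H choose 2"
  shows "edges H = {e. e \<subseteq> verts H \<and> card e = 2}"
proof (rule card_subset_eq)
  show "finite {e. e \<subseteq> verts H \<and> card e = 2}"
    using fin_graph_edges(1)[OF assms(1)] by simp
  show "edges H \<subseteq> {e. e \<subseteq> verts H \<and> card e = 2}"
    using assms(1) by (auto simp: fin_graph_def)
  show "card (edges H) = card {e. e \<subseteq> verts H \<and> card e = 2}"
    using assms n_subsets[OF fin_graph_edges(1)[OF assms(1)], of 2] by (simp add: en_def vn_def)
qed

lemma strictly_2_balanced_triangle: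
  assumes "fin_graph H" "strictly_2_balanced H" "1 < m2_dens H" "vn H = 3"
  shows "m2_dens H = 2" "edges H = {e. e \<subseteq> verts H \<and> card e = 2}"
proof -
  note H = strictly_2_balanced_dens[OF assms(1-3)]
  have "en H = 3"
    using H(4) assms(4) en_le_choose[OF assms(1)] by simp
  then show "m2_dens H = 2" "edges H = {e. e \<subseteq> verts H \<and> card e = 2}"
    using H(3) assms(4) complete_if_en_eq_choose[OF assms(1)] by (auto simp: choose_two)
qed

text \<open>Deleting \<open>x\<close> lowers \<open>v - 2\<close> by one and yields a density
  strictly below \<open>m2_dens H\<close>, so more than \<open>m2_dens H\<close> edges disappear.
  The remainder needs three vertices for the formula; in a triangle the degrees only equal
  \<open>m2_dens H\<close>.\<close>

lemma strictly_2_balanced_degree: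
  assumes "fin_graph H" "strictly_2_balanced H" "1 < m2_dens H" "4 \<le> vn H" "x \<in> verts H"
  shows "m2_dens H < real (card (nbrs (edges H) (verts H) x))"
proof -
  note H = strictly_2_balanced_dens[OF assms(1-3)]
  define K where "K = delete_vertex H x"
  note K = delete_vertex[OF assms(1,5), folded K_def]
  have "d2_dens K < m2_dens H"
    using assms(2) K(1) unfolding strictly_2_balanced_def by blast
  moreover have "3 \<le> vn K"
    using K(2) assms(4) by linarith
  ultimately have "real (en K) - 1 < m2_dens H * (real (vn K) - 2)"
  proof (cases "en K = 0")
    case True
    have "0 \<le> m2_dens H * (real (vn K) - 2)"
      using assms(3) \<open>3 \<le> vn K\<close> by simp
    then show ?thesis
      using True by simp
  next
    case False
    then have "(real (en K) - 1) / (real (vn K) - 2) < m2_dens H"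
      using \<open>d2_dens K < m2_dens H\<close> \<open>3 \<le> vn K\<close> by (simp add: d2_dens_def nonempty_graph_if_en_pos)
    then show ?thesis
      using \<open>3 \<le> vn K\<close> by (simp add: pos_divide_less_eq)
  qed
  then show ?thesis
    using K(2,3) H(3) by (simp add: algebra_simps)
qed

lemma strictly_2_balanced_degree_ge_2:
  assumes "fin_graph H" "strictly_2_balanced H" "1 < m2_dens H" "x \<in> verts H"
  shows "2 \<le> card (nbrs (edges H) (verts H) x)"
proof (cases "4 \<le> vn H")
  case True
  then show ?thesis
    using strictly_2_balanced_degree[OF assms(1-3) True assms(4)] assms(3) by linarith
next
  case False
  then have three: "vn H = 3"
    using strictly_2_balanced_dens(2)[OF assms(1-3)] by simp
  have "nbrs (edges H) (verts H) x = verts H - {x}"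
    using assms(4) unfolding nbrs_def strictly_2_balanced_triangle(2)[OF assms(1-3) three]
    by (auto simp: card_insert_if)
  then show ?thesis
    using three assms(4) by (simp add: vn_def card_Diff_singleton)
qed

text \<open>Put \<open>b = m2_dens H2\<close>. As
  \<open>b * (v - 2) + 1 = b * (v - 2 + 1 / b)\<close>, a subgraph with \<open>d2_dens J > b\<close>
  also has \<open>d2_asym J H2 > b\<close>, so the maximum \<open>m\<close> exceeds
  \<open>b\<close>. Since \<open>m / b > 1\<close>, the equation for \<open>en H1\<close> becomes
  the strict inequality, and comparison with a complete graph bounds \<open>2 * m\<close>. Degrees
  are bounded by deleting a vertex; three vertices are enough here, because the formula of
  \<open>d2_asym\<close> already holds on two.\<close>

lemma asymmetric_dens:
  assumes "fin_graph H1" "fin_graph H2" "heart H1 H2" "1 < m2_dens H2" "m2_dens H2 < m2_dens H1"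
  shows "m2_dens H2 < m2_asym H1 H2" "3 \<le> vn H1"
    "real (en H1) = m2_asym H1 H2 * (real (vn H1) - 2 + 1 / m2_dens H2)"
    "m2_asym H1 H2 * (real (vn H1) - 2) < real (en H1) - 1"
    "2 * m2_asym H1 H2 < real (vn H1) + 1"
    "\<And>x. x \<in> verts H1 \<Longrightarrow> m2_asym H1 H2 < real (card (nbrs (edges H1) (verts H1) x))"
proof -
  define m where "m = m2_asym H1 H2"
  define b where "b = m2_dens H2"
  have H2: "strictly_2_balanced H2" and sb: "\<And>J. proper_subgraph J H1 \<Longrightarrow> d2_asym J H2 < m"
    using assms(3,5) unfolding heart_def strictly_balanced_wrt_def m_def by blast+
  have ne: "nonempty_graph H2"
    using strictly_2_balanced_dens(1)[OF assms(2) H2 assms(4)] .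
  obtain J where J: "subgraph J H1" "d2_dens J = m2_dens H1"
    using Max_dens_witness[OF assms(1), of d2_dens] unfolding m2_dens_def .
  have d: "1 < d2_dens J" "b < d2_dens J"
    using J assms(4,5) by (auto simp: b_def)
  note J3 = d2_dens_gt_1_D[OF d(1)]
  have b: "1 < b" "b * (1 / b) = 1" "0 < 1 / b"
    using assms(4) by (auto simp: b_def)
  have "b * (real (vn J) - 2) < real (en J) - 1"
    using d(2) J3 by (simp add: field_simps)
  then have "b * (real (vn J) - 2 + 1 / b) < real (en J)"
    using b(2) by (simp add: algebra_simps)
  then have "b < real (en J) / (real (vn J) - 2 + 1 / b)"
    using J3(2) b(3) by (subst pos_less_divide_eq) linarith+
  then have "b < d2_asym J H2"
    using ne J3(2) by (simp add: d2_asym_def b_def)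
  then show bm: "m2_dens H2 < m2_asym H1 H2"
    using Max_dens_ge[OF assms(1) J(1), of "\<lambda>J. d2_asym J H2"] by (simp add: m2_asym_def b_def)
  have "vn J \<le> vn H1"
    using J(1) fin_graph_edges(1)[OF assms(1)] by (auto simp: subgraph_def vn_def intro: card_mono)
  then show v: "3 \<le> vn H1"
    using J3(2) by simp
  obtain K where K: "subgraph K H1" "d2_asym K H2 = m"
    using Max_dens_witness[OF assms(1), of "\<lambda>J. d2_asym J H2"] unfolding m2_asym_def m_def .
  then have "K = H1"
    using sb unfolding proper_subgraph_def by (metis less_irrefl)
  then have "m = real (en H1) / (real (vn H1) - 2 + 1 / b)"
    using K ne v by (simp add: d2_asym_def b_def)
  moreover have pos: "0 < real (vn H1) - 2 + 1 / b"
    using v b(3) by linarith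
  ultimately have e: "real (en H1) = m * (real (vn H1) - 2 + 1 / b)"
    by simp
  then show "real (en H1) = m2_asym H1 H2 * (real (vn H1) - 2 + 1 / m2_dens H2)"
    by (simp add: m_def b_def)
  have "1 < m * (1 / b)"
    using bm b(1) by (simp add: m_def b_def)
  then have lt: "m * (real (vn H1) - 2) < real (en H1) - 1"
    using e by (simp add: algebra_simps)
  then show "m2_asym H1 H2 * (real (vn H1) - 2) < real (en H1) - 1"
    by (simp add: m_def)
  have "2 * m * (real (vn H1) - 2) < (real (vn H1) + 1) * (real (vn H1) - 2)"
    using lt en_le_choose[OF assms(1)] by (simp add: algebra_simps)
  then show "2 * m2_asym H1 H2 < real (vn H1) + 1"
    using v by (simp add: m_def mult_less_cancel_right)
  fix x assume x: "x \<in> verts H1"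
  define D where "D = delete_vertex H1 x"
  note D = delete_vertex[OF assms(1) x, folded D_def]
  have pD: "0 < real (vn D) - 2 + 1 / b" "2 \<le> vn D"
    using D(2) v b(3) by linarith+
  have "real (en D) / (real (vn D) - 2 + 1 / b) < m"
    using sb[OF D(1)] ne pD(2) by (simp add: d2_asym_def b_def)
  then have "real (en D) < m * (real (vn D) - 2 + 1 / b)"
    using pD(1) by (simp add: pos_divide_less_eq)
  then show "m2_asym H1 H2 < real (card (nbrs (edges H1) (verts H1) x))"
    using D(2,3) e by (simp add: m_def algebra_simps)
qed

text \<open>With \<open>b\<close> the common value, \<open>d2_dens J \<le> b\<close> and
  \<open>d2_asym J H2 \<le> b\<close> both amount to \<open>en J \<le> b * (vn J - 2) + 1\<close>.
  This lets the case of equal densities work with \<open>m2_dens\<close> alone.\<close>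

lemma m2_asym_le_if_eq:
  assumes "fin_graph H1" "m2_dens H1 = m2_dens H2" "1 < m2_dens H2"
  shows "m2_asym H1 H2 \<le> m2_dens H1"
proof -
  define b where "b = m2_dens H2"
  have b: "1 < b" "b * (1 / b) = 1" "0 < 1 / b"
    using assms(3) by (auto simp: b_def)
  obtain J where J: "subgraph J H1" "d2_asym J H2 = m2_asym H1 H2"
    using Max_dens_witness[OF assms(1), of "\<lambda>J. d2_asym J H2"] unfolding m2_asym_def .
  have fJ: "fin_graph J"
    using J(1) by (simp add: subgraph_def)
  have "d2_asym J H2 \<le> b"
  proof (cases "nonempty_graph H2 \<and> 2 \<le> vn J")
    case True
    have "real (en J) \<le> b * (real (vn J) - 2) + 1"
    \<comment> \<open>Such \<open>J\<close> fall outside the main branch of \<open>d2_dens\<close>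
      and are bounded directly.\<close>
    proof (cases "en J = 0 \<or> vn J = 2")
      case True
      have "0 \<le> b * (real (vn J) - 2)"
        using b \<open>nonempty_graph H2 \<and> 2 \<le> vn J\<close> by simp
      then show ?thesis
        using True en_le_choose[OF fJ] by auto
    next
      case False
      then have "3 \<le> vn J" "nonempty_graph J"
        using \<open>nonempty_graph H2 \<and> 2 \<le> vn J\<close> by (auto intro: nonempty_graph_if_en_pos)
      moreover have "d2_dens J \<le> b"
        using Max_dens_ge[OF assms(1) J(1), of d2_dens] assms(2) by (simp add: m2_dens_def b_def)
      ultimately show ?thesis
        by (simp add: d2_dens_def field_simps)
    qed
    then have "real (en J) \<le> b * (real (vn J) - 2 + 1 / b)"
      using b(2) by (simp add: algebra_simps)
    moreover have "0 < real (vn J) - 2 + 1 / b"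
      using True b(3) by linarith
    ultimately have "real (en J) / (real (vn J) - 2 + 1 / b) \<le> b"
      by (simp add: pos_divide_le_eq)
    then show ?thesis
      using True by (simp add: d2_asym_def b_def)
  qed (use b in \<open>auto simp: d2_asym_def\<close>)
  then show ?thesis
    using J(2) assms(2) by (simp add: b_def)
qed

section \<open>Colourings of the host graph\<close>

lemma not_arrows_two_sparse:
  assumes "fin_graph G" "0 \<le> t1" "t1 \<le> k1" "0 \<le> t2" "t2 \<le> k2"
    and "\<And>S. S \<subseteq> verts G \<Longrightarrow> 2 \<le> card S \<Longrightarrow>
      int (card (induced_edges (edges G) S)) \<le> (k1 + k2) * int (card S) - t1 - t2"
    and "subgraph K1 H1" "2 \<le> vn K1" "k1 * int (vn K1) - t1 < int (en K1)"
    and "subgraph K2 H2" "2 \<le> vn K2" "k2 * int (vn K2) - t2 < int (en K2)"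
  shows "\<not> arrows G H1 H2"
proof -
  obtain I1 I2 where I: "I1 \<union> I2 = edges G" "sparse k1 t1 I1" "sparse k2 t2 I2"
    using partition_into_two_sparse_local[OF fin_graph_edges(1-3)[OF assms(1)] assms(2-6)] by metis
  show ?thesis
  proof (rule not_arrows_if_partition)
    fix J assume J: "subgraph J G" "isomorphic J H1" "edges J \<subseteq> I1"
    show False
      using no_copy_in_sparse[OF I(2) J(3,2) _ assms(7-9)] J(1) by (simp add: subgraph_def)
  next
    fix J assume J: "subgraph J G" "isomorphic J H2" "edges J \<subseteq> edges G - I1"
    then have "edges J \<subseteq> I2"
      using I(1) by auto
    then show False
      using no_copy_in_sparse[OF I(3) _ J(2) _ assms(10-12)] J(1) by (simp add: subgraph_def)
  qed
qed

text \<open>\<open>F\<close> has at least as many edges as vertices and so is not a forest. Both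
  orders are needed: the edge bound of bipartite graphs is available for \<open>H1\<close> when it
  is complete bipartite, but for \<open>H2\<close> in the case of equal densities.\<close>

lemma not_arrows_forest_plus_sparse:
  assumes "fin_graph G" "m_dens G \<le> m" "1 \<le> m" "fin_graph H" "fin_graph F"
    and "4 \<le> vn H" "4 * en H \<le> (vn H)\<^sup>2" "m * (real (vn H) - 2) \<le> real (en H) - 1"
    and "real_of_int \<lfloor>m\<rfloor> * (real (vn H) - 2) < real (en H) - 1"
    and "2 \<le> vn F" "vn F \<le> en F"
  shows "\<not> arrows G H F" "\<not> arrows G F H"
proof -
  obtain A R where AR: "A \<union> R = edges G" "A \<inter> R = {}" "sparse 1 1 A"
    "\<And>S. finite S \<Longrightarrow> card S = vn H \<Longrightarrow> card (induced_edges R S) < en H"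
    using partition_forest_plus_sparse[OF fin_graph_edges(1-3)[OF assms(1)]
        card_induced_edges_le_m_dens[OF assms(1,2)] assms(3,6-9)] by metis
  have H: False if J: "subgraph J G" "isomorphic J H" "edges J \<subseteq> R" for J
  proof -
    have fJ: "fin_graph J"
      using J(1) by (simp add: subgraph_def)
    have "card (edges J) \<le> card (induced_edges R (verts J))"
      using J(3) fJ fin_graph_edges[OF fJ] by (intro card_mono) (auto simp: induced_edges_def)
    then show False
      using AR(4)[of "verts J"] isomorphic_card_eq[OF J(2) fJ] fin_graph_edges(1)[OF fJ]
      by (simp add: vn_def en_def)
  qed
  have F: False if J: "subgraph J G" "isomorphic J F" "edges J \<subseteq> A" for J
    using no_copy_in_sparse[OF AR(3) J(3,2) _ subgraph_refl[OF assms(5)] assms(10)] J(1) assms(11)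
    by (simp add: subgraph_def)
  show "\<not> arrows G H F"
    by (rule not_arrows_if_partition[where R = R]) (use H F AR(1) in blast)+
  show "\<not> arrows G F H"
    by (rule not_arrows_if_partition[where R = A]) (use H F AR(1) in blast)+
qed

text \<open>Inside the classes every vertex set has a vertex of degree below \<open>d\<close>, which
  excludes \<open>H\<close>; the edges between classes are \<open>q\<close>-colourable, which
  excludes \<open>F\<close>.\<close>

lemma not_arrows_vertex_partition:
  fixes q d :: nat
  assumes "fin_graph G" "m_dens G \<le> m" "2 * m < real (q * d)" "verts H \<noteq> {}"
    and "\<And>v. v \<in> verts H \<Longrightarrow> d \<le> card (nbrs (edges H) (verts H) v)"
    and "\<not> colourable F q"
  shows "\<not> arrows G H F" "\<not> arrows G F H"
proof -
  obtain f :: "'a \<Rightarrow> nat" where f: "\<forall>v\<in>verts G. f v < q"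
    "\<And>S. S \<subseteq> verts G \<Longrightarrow> S \<noteq> {} \<Longrightarrow> \<exists>v\<in>S. card {u \<in> nbrs (edges G) S v. f u = f v} < d"
    using vertex_partition_degenerate[OF fin_graph_edges(3,1)[OF assms(1)] assms(3)
        card_induced_edges_le_m_dens[OF assms(1,2)]] by metis
  define R where "R = {e \<in> edges G. \<exists>u v. e = {u, v} \<and> f u = f v}"
  have "nbrs R S v = {u \<in> nbrs (edges G) S v. f u = f v}" for S v
    by (auto simp: nbrs_def R_def doubleton_eq_iff)
  then have R: "\<exists>v\<in>S. card (nbrs R S v) < d" if "S \<subseteq> verts G" "S \<noteq> {}" for S
    using f(2)[OF that] by simp
  have H: False if J: "subgraph J G" "isomorphic J H" "edges J \<subseteq> R" for J
    using no_copy_in_degenerate[of "verts G" R d J H, OF R J(3) _ J(2) _ assms(4,5)] J(1)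
    by (simp add: subgraph_def)
  have F: False if J: "subgraph J G" "isomorphic J F" "edges J \<subseteq> edges G - R" for J
  proof -
    have "edges J \<subseteq> {e \<in> edges G. \<exists>u v. e = {u, v} \<and> f u \<noteq> f v}"
    proof
      fix e assume e: "e \<in> edges J"
      then have "e \<in> edges G" "e \<notin> R"
        using J(3) by auto
      moreover have "card e = 2"
        using fin_graph_edges(3)[OF assms(1)] \<open>e \<in> edges G\<close> by blast
      then obtain u v where "e = {u, v}"
        by (auto simp: card_2_iff)
      ultimately show "e \<in> {e \<in> edges G. \<exists>u v. e = {u, v} \<and> f u \<noteq> f v}"
        by (auto simp: R_def)
    qed
    then have "colourable J q"
      using colourable_cross_edges[OF J(1) _ f(1)] by blast
    then show False
      using colourable_isomorphic[OF J(2)] J(1) assms(6) by (simp add: subgraph_def)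
  qed
  show "\<not> arrows G H F"
    by (rule not_arrows_if_partition[where R = R]) (use H F in blast)+
  have "edges G - (edges G - R) = R"
    by (auto simp: R_def)
  then show "\<not> arrows G F H"
    using not_arrows_if_partition[of G F "edges G - R" H] H F by metis
qed

lemma card_induced_edges_le_pseudoforests:
  assumes "fin_graph G" "m_dens G \<le> m" "m \<le> real_of_int k" "S \<subseteq> verts G"
  shows "int (card (induced_edges (edges G) S)) \<le> k * int (card S)"
proof -
  have "m * real (card S) \<le> real_of_int k * real (card S)"
    using assms(3) by (intro mult_right_mono) auto
  then have "real_of_int (int (card (induced_edges (edges G) S))) \<le> real_of_int (k * int (card S))"
    using card_induced_edges_le_m_dens[OF assms(1,2,4)] by simp
  then show ?thesis
    by (simp only: of_int_le_iff)
qed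

text \<open>The vertex sets with at most \<^term>\<open>2 * m + 1\<close> elements have few edges because they are small.\<close>

lemma card_induced_edges_le_forests:
  assumes "fin_graph G" "m_dens G \<le> m" "m + 1 / 2 \<le> real_of_int k" "S \<subseteq> verts G" "2 \<le> card S"
  shows "int (card (induced_edges (edges G) S)) \<le> k * int (card S) - k"
proof -
  define n where "n = real (card S)"
  have fS: "finite S"
    using assms(1,4) fin_graph_edges(1) finite_subset by blast
  have n: "2 \<le> n"
    using assms(5) by (simp add: n_def)
  have "real (card (induced_edges (edges G) S)) \<le> (m + 1 / 2) * (n - 1)"
  proof (cases "2 * m + 1 \<le> n")
    case True
    have "real (card (induced_edges (edges G) S)) \<le> m * n"
      using card_induced_edges_le_m_dens[OF assms(1,2,4)] by (simp add: n_def)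
    \<comment> \<open>The added term is exactly the difference between
      \<open>(m + 1 / 2) * (n - 1)\<close> and \<open>m * n\<close>.\<close>
    also have "\<dots> \<le> m * n + (n - (2 * m + 1)) / 2"
      using True by simp
    also have "\<dots> = (m + 1 / 2) * (n - 1)"
      by (simp add: field_simps)
    finally show ?thesis .
  next
    case False
    have "real (card (induced_edges (edges G) S)) \<le> n * (n - 1) / 2"
      using card_induced_edges_le_choose[OF fS fin_graph_edges(3)[OF assms(1)]] unfolding n_def
      by (metis of_nat_le_iff real_choose_two)
    also have "\<dots> \<le> (2 * m + 1) * (n - 1) / 2"
      using False n by (intro divide_right_mono mult_right_mono) auto
    also have "\<dots> = (m + 1 / 2) * (n - 1)"
      by (simp add: field_simps)
    finally show ?thesis .
  qed
  also have "\<dots> \<le> real_of_int k * (n - 1)"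
    using assms(3) n by (intro mult_right_mono) auto
  finally have "real_of_int (int (card (induced_edges (edges G) S))) \<le> real_of_int (k * int (card S) - k)"
    by (simp add: n_def algebra_simps)
  then show ?thesis
    by (simp only: of_int_le_iff)
qed

lemma vn_le_if_complete_colourable:
  assumes "finite (verts H)" "\<And>u v. u \<in> verts H \<Longrightarrow> v \<in> verts H \<Longrightarrow> u \<noteq> v \<Longrightarrow> {u, v} \<in> edges H"
    and "colourable H k"
  shows "vn H \<le> k"
proof -
  obtain c :: "'a \<Rightarrow> nat" where c: "\<forall>v\<in>verts H. c v < k" "\<forall>u v. {u, v} \<in> edges H \<longrightarrow> c u \<noteq> c v"
    using assms(3) by (auto simp: colourable_def)
  have "inj_on c (verts H)"
    using assms(2) c(2) by (auto simp: inj_on_def)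
  then have "card (verts H) \<le> card {..<k}"
    using c(1) by (intro card_inj_on_le[where f = c]) auto
  then show ?thesis
    by (simp add: vn_def)
qed

lemma colourable_2_en_le:
  assumes "fin_graph H" "colourable H 2"
  shows "4 * en H \<le> (vn H)\<^sup>2"
proof -
  obtain c :: "'a \<Rightarrow> nat" where c: "\<forall>v\<in>verts H. c v < 2" "\<forall>u v. {u, v} \<in> edges H \<longrightarrow> c u \<noteq> c v"
    using assms(2) by (auto simp: colourable_def)
  define A where "A = {v \<in> verts H. c v = 0}"
  define B where "B = {v \<in> verts H. c v = 1}"
  have fin: "finite A" "finite B"
    using fin_graph_edges(1)[OF assms(1)] by (auto simp: A_def B_def)
  have "verts H = A \<union> B" "A \<inter> B = {}"
    using c(1) by (auto simp: A_def B_def less_2_cases_iff)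
  then have v: "vn H = card A + card B"
    using fin by (simp add: vn_def card_Un_disjoint)
  have "edges H \<subseteq> (\<lambda>(a, b). {a, b}) ` (A \<times> B)"
  proof
    fix e assume e: "e \<in> edges H"
    then have "card e = 2" "e \<subseteq> verts H"
      using assms(1) by (auto simp: fin_graph_def)
    then obtain u w where uw: "e = {u, w}" "u \<in> verts H" "w \<in> verts H"
      by (auto simp: card_2_iff)
    then have "c u \<noteq> c w" "c u < 2" "c w < 2"
      using c e by auto
    then have "u \<in> A \<and> w \<in> B \<or> w \<in> A \<and> u \<in> B"
      using uw by (auto simp: A_def B_def less_2_cases_iff)
    then show "e \<in> (\<lambda>(a, b). {a, b}) ` (A \<times> B)"
      using uw(1) by (auto simp: image_iff insert_commute)
  qed
  then have "card (edges H) \<le> card (A \<times> B)"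
    using fin by (meson card_image_le card_mono finite_SigmaI finite_imageI le_trans)
  then have "en H \<le> card A * card B"
    using fin by (simp add: en_def card_cartesian_product)
  then have "int (en H) \<le> int (card A) * int (card B)"
    by (metis of_nat_le_iff of_nat_mult)
  moreover have "0 \<le> (int (card A) - int (card B))\<^sup>2"
    by simp
  ultimately have "4 * int (en H) \<le> (int (card A) + int (card B))\<^sup>2"
    by (simp add: power2_eq_square algebra_simps)
  then have "int (4 * en H) \<le> int ((vn H)\<^sup>2)"
    by (simp add: v)
  then show ?thesis
    by (simp only: of_nat_le_iff)
qed

section \<open>Equal densities\<close>

text \<open>The red edges of \<open>K\<^sub>5\<close> in its decomposition into two five-cycles.\<close>

definition pentagon :: "nat \<Rightarrow> nat \<Rightarrow> bool" where
  "pentagon i j \<longleftrightarrow> (i + 1) mod 5 = j \<or> (j + 1) mod 5 = i"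

lemma pentagon_no_monochromatic_triangle:
  assumes "a < 5" "b < 5" "c < 5" "a \<noteq> b" "b \<noteq> c" "a \<noteq> c"
  shows "\<not> (pentagon a b \<and> pentagon b c \<and> pentagon a c)"
    "pentagon a b \<or> pentagon b c \<or> pentagon a c"
proof -
  have "a = 0 \<or> a = 1 \<or> a = 2 \<or> a = 3 \<or> a = 4" "b = 0 \<or> b = 1 \<or> b = 2 \<or> b = 3 \<or> b = 4"
    "c = 0 \<or> c = 1 \<or> c = 2 \<or> c = 3 \<or> c = 4"
    using assms(1-3) by linarith+
  then show "\<not> (pentagon a b \<and> pentagon b c \<and> pentagon a c)"
    "pentagon a b \<or> pentagon b c \<or> pentagon a c"
    using assms(4-6) unfolding pentagon_def by (elim disjE; simp)+
qed

text \<open>Triangles need their own colouring: their degrees equal the density 2 instead of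
  exceeding it, so two vertex classes do not suffice.\<close>

lemma not_arrows_triangles:
  assumes "fin_graph G" "m_dens G \<le> 2" "vn H1 = 3" "en H1 = 3" "vn H2 = 3" "en H2 = 3"
  shows "\<not> arrows G H1 H2"
proof -
  have E: "\<forall>e\<in>edges G. card e = 2"
    using fin_graph_edges(3)[OF assms(1)] .
  \<comment> \<open>\<open>q = 5\<close> and \<open>d = 1\<close> are admissible as
    \<open>2 * 2 < 5\<close>; applied to the two ends of an edge, \<open>d = 1\<close> says that the
    colouring is proper.\<close>
  obtain f :: "'a \<Rightarrow> nat" where f: "\<forall>v\<in>verts G. f v < 5"
    "\<And>S. S \<subseteq> verts G \<Longrightarrow> S \<noteq> {} \<Longrightarrow> \<exists>v\<in>S. card {u \<in> nbrs (edges G) S v. f u = f v} < 1"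
    using vertex_partition_degenerate[OF E fin_graph_edges(1)[OF assms(1)], of 2 5 1]
      card_induced_edges_le_m_dens[OF assms(1,2)] by auto
  have proper: "f u \<noteq> f v" if uv: "{u, v} \<in> edges G" for u v
  proof
    assume same: "f u = f v"
    have "{u, v} \<subseteq> verts G"
      using uv fin_graph_edges(2)[OF assms(1)] by auto
    then obtain w where w: "w \<in> {u, v}" "card {x \<in> nbrs (edges G) {u, v} w. f x = f w} < 1"
      using f(2)[of "{u, v}"] by auto
    have "{x \<in> nbrs (edges G) {u, v} w. f x = f w} \<noteq> {}"
      using w(1) uv same by (auto simp: nbrs_def insert_commute)
    moreover have "finite {x \<in> nbrs (edges G) {u, v} w. f x = f w}"
      by (simp add: nbrs_def)
    ultimately have "0 < card {x \<in> nbrs (edges G) {u, v} w. f x = f w}"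
      by (simp only: card_gt_0_iff not_False_eq_True simp_thms)
    then show False
      using w(2) by linarith
  qed
  have tri: "\<exists>x y z. {x, y} \<in> edges J \<and> {y, z} \<in> edges J \<and> {x, z} \<in> edges J"
    if J: "fin_graph J" "vn J = 3" "en J = 3" for J :: "'a ugraph"
  proof -
    obtain x y z where xyz: "verts J = {x, y, z}" "x \<noteq> y" "y \<noteq> z" "x \<noteq> z"
      using J(2) by (auto simp: vn_def card_3_iff)
    have "edges J = {e. e \<subseteq> verts J \<and> card e = 2}"
      using J by (intro complete_if_en_eq_choose) (auto simp: choose_two)
    then have "{x, y} \<in> edges J" "{y, z} \<in> edges J" "{x, z} \<in> edges J"
      using xyz by simp_all
    then show ?thesis
      by blast
  qed
  define R where "R = {e \<in> edges G. \<exists>u v. e = {u, v} \<and> pentagon (f u) (f v)}"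
  have R: "{u, v} \<in> R \<longleftrightarrow> pentagon (f u) (f v)" if "{u, v} \<in> edges G" for u v
    using that by (auto simp: R_def doubleton_eq_iff pentagon_def)
  have bound: "f u < 5" "f v < 5" if "{u, v} \<in> edges G" for u v
    using that f(1) fin_graph_edges(2)[OF assms(1)] by auto
  show ?thesis
  proof (rule not_arrows_if_partition)
    fix J assume J: "subgraph J G" "isomorphic J H1" "edges J \<subseteq> R"
    then have "fin_graph J"
      by (simp add: subgraph_def)
    then have "fin_graph J" "vn J = 3" "en J = 3"
      using isomorphic_card_eq[OF J(2)] assms(3,4) by simp_all
    then obtain x y z where e: "{x, y} \<in> edges J" "{y, z} \<in> edges J" "{x, z} \<in> edges J"
      using tri by blast
    then have "{x, y} \<in> edges G" "{y, z} \<in> edges G" "{x, z} \<in> edges G"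
      using J(1) by (auto simp: subgraph_def)
    then show False
      using pentagon_no_monochromatic_triangle(1)[of "f x" "f y" "f z"] bound proper R e J(3) by blast
  next
    fix J assume J: "subgraph J G" "isomorphic J H2" "edges J \<subseteq> edges G - R"
    then have "fin_graph J"
      by (simp add: subgraph_def)
    then have "fin_graph J" "vn J = 3" "en J = 3"
      using isomorphic_card_eq[OF J(2)] assms(5,6) by simp_all
    then obtain x y z where e: "{x, y} \<in> edges J" "{y, z} \<in> edges J" "{x, z} \<in> edges J"
      using tri by blast
    then have "{x, y} \<in> edges G" "{y, z} \<in> edges G" "{x, z} \<in> edges G"
      using J(1) by (auto simp: subgraph_def)
    then show False
      using pentagon_no_monochromatic_triangle(2)[of "f x" "f y" "f z"] bound proper R e J(3) by blast
  qed
qed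

lemma not_arrows_symmetric_density:
  assumes "fin_graph G" "fin_graph H1" "fin_graph H2"
    and "strictly_2_balanced H1" "strictly_2_balanced H2"
    and "m2_dens H1 = m2_dens H2" "1 < m2_dens H2" "m_dens G \<le> m2_dens H2"
  shows "\<not> arrows G H1 H2"
proof -
  define m where "m = m2_dens H2"
  have m1: "m2_dens H1 = m" "1 < m2_dens H1" "1 < m" and G: "m_dens G \<le> m"
    using assms(6-8) by (auto simp: m_def)
  note D1 = strictly_2_balanced_dens[OF assms(2,4) m1(2), unfolded m1(1)]
  note D2 = strictly_2_balanced_dens[OF assms(3,5,7), folded m_def]
  \<comment> \<open>The least integer above \<open>m\<close>: degrees that exceed \<open>m\<close>
    are at least \<open>d\<close>, and two classes suffice since
    \<open>2 * m < 2 * d\<close>.\<close>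
  define d where "d = nat \<lfloor>m\<rfloor> + 1"
  have d: "m < real d" "\<And>k. m < real k \<Longrightarrow> d \<le> k"
    using m1(3) unfolding d_def by linarith+
  then have dm: "2 * m < real (2 * d)"
    by simp
  have deg1: "d \<le> card (nbrs (edges H1) (verts H1) v)" if "4 \<le> vn H1" "v \<in> verts H1" for v
    using strictly_2_balanced_degree[OF assms(2,4) m1(2) that] m1(1) by (intro d(2)) simp
  have deg2: "d \<le> card (nbrs (edges H2) (verts H2) v)" if "4 \<le> vn H2" "v \<in> verts H2" for v
    using strictly_2_balanced_degree[OF assms(3,5,7) that] by (intro d(2)) (simp add: m_def)
  have ne: "verts H1 \<noteq> {}" "verts H2 \<noteq> {}"
    using D1(2) D2(2) by (auto simp: vn_def)
  have tri1: "m = 2" "en H1 = 3" "\<not> colourable H1 2" if three: "vn H1 = 3"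
  proof -
    note T = strictly_2_balanced_triangle[OF assms(2,4) m1(2) three]
    show "m = 2"
      using T(1) m1(1) by simp
    then show "en H1 = 3"
      using D1(3) three by simp
    show "\<not> colourable H1 2"
      using vn_le_if_complete_colourable[of H1 2] T(2) three fin_graph_edges(1)[OF assms(2)] by auto
  qed
  have tri2: "en H2 = 3" "\<not> colourable H2 2" if three: "vn H2 = 3"
  proof -
    note T = strictly_2_balanced_triangle[OF assms(3,5,7) three]
    show "en H2 = 3"
      using D2(3) three T(1) by (simp add: m_def)
    show "\<not> colourable H2 2"
      using vn_le_if_complete_colourable[of H2 2] T(2) three fin_graph_edges(1)[OF assms(3)] by auto
  qed
  show ?thesis
  proof (cases "vn H1 = 3")
    case True
    show ?thesis
    proof (cases "vn H2 = 3")
      case three: True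
      show ?thesis
        using not_arrows_triangles[OF assms(1) _ True tri1(2)[OF True] three tri2(1)[OF three]] G tri1(1)[OF True]
        by simp
    next
      case False
      \<comment> \<open>The roles are exchanged here: the triangle \<open>H1\<close> is not
        2-colourable, and the degrees of \<open>H2\<close> exceed \<open>m\<close>.\<close>
      then have "4 \<le> vn H2"
        using D2(2) by simp
      then show ?thesis
        using not_arrows_vertex_partition(2)[OF assms(1) G dm ne(2) deg2 tri1(3)[OF True]] by blast
    qed
  next
    case False
    then have v1: "4 \<le> vn H1"
      using D1(2) by simp
    show ?thesis
    proof (cases "colourable H2 2")
      case False
      then show ?thesis
        using not_arrows_vertex_partition(1)[OF assms(1) G dm ne(1) deg1[OF v1]] by blast
    next
      case True
      then have v2: "4 \<le> vn H2"
        using tri2(2) D2(2) by force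
      have bip: "4 * en H2 \<le> (vn H2)\<^sup>2"
        using colourable_2_en_le[OF assms(3) True] .
      show ?thesis
      proof (cases "real_of_int \<lfloor>m\<rfloor> < m")
        case True
        \<comment> \<open>The fractional part of \<open>m\<close> restores strictness to the
          equation for \<open>en H2 - 1\<close>.\<close>
        then have "real_of_int \<lfloor>m\<rfloor> * (real (vn H2) - 2) < real (en H2) - 1"
          unfolding D2(3) using v2 by (intro mult_strict_right_mono) auto
        then show ?thesis
          using not_arrows_forest_plus_sparse(2)[OF assms(1) G _ assms(3,2) v2 bip] D2(3) D1(2,4) m1(3) by simp
      next
        case False
        \<comment> \<open>For integral \<open>m\<close>, \<open>L\<close> pseudoforests cover
          \<open>G\<close>: one for \<open>H1\<close>, which has more edges than vertices, and
          \<open>L - 1\<close> for \<open>H2\<close>, where bipartiteness gives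
          \<open>v(H2) \<ge> 4 * m - 2\<close>.\<close>
        define L where "L = \<lfloor>m\<rfloor>"
        have L: "real_of_int L = m" "2 \<le> L"
          using False m1(3) unfolding L_def by linarith+
        have "2 * (real (vn H1) - 2) \<le> m * (real (vn H1) - 2)"
          using L v1 by (intro mult_right_mono) auto
        then have e1: "real (vn H1) < real (en H1)"
          using D1(3) of_nat_mono[OF v1, where 'a = real] by simp
        have "4 * m \<le> real (vn H2) + 2"
          using v2 bip D2(3) by (intro four_mult_le_if_bipartite_density) auto
        then have "(m - 1) * real (vn H2) < real (en H2)"
          using D2(3) m1(3) by (simp add: algebra_simps)
        then have "real_of_int ((L - 1) * int (vn H2)) < real_of_int (int (en H2))"
          using L(1) by simp
        then have e2: "(L - 1) * int (vn H2) < int (en H2)"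
          by (simp only: of_int_less_iff)
        show ?thesis
          using card_induced_edges_le_pseudoforests[OF assms(1) G, of L] L e1 e2 v1 v2
          by (intro not_arrows_two_sparse[OF assms(1), of 0 1 0 "L - 1" H1 H1 H2 H2])
            (auto simp: subgraph_refl assms)
      qed
    qed
  qed
qed

section \<open>Recognising cycles among strictly 2-balanced graphs\<close>

text \<open>All neighbours of the first vertex of a longest path lie on the path;
  the one furthest along closes a cycle.\<close>

lemma cycle_if_min_degree_2:
  assumes "fin_graph H" "verts H \<noteq> {}"
    and "\<And>x. x \<in> verts H \<Longrightarrow> 2 \<le> card (nbrs (edges H) (verts H) x)"
  obtains ys where "distinct ys" "set ys \<subseteq> verts H" "3 \<le> length ys"
    "\<And>i. i < length ys \<Longrightarrow> {ys ! i, ys ! ((i + 1) mod length ys)} \<in> edges H"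
proof -
  define path where "path = (\<lambda>xs. xs \<noteq> [] \<and> distinct xs \<and> set xs \<subseteq> verts H \<and>
    (\<forall>i. Suc i < length xs \<longrightarrow> {xs ! i, xs ! Suc i} \<in> edges H))"
  have fV: "finite (verts H)"
    using fin_graph_edges(1)[OF assms(1)] .
  obtain a where "a \<in> verts H"
    using assms(2) by auto
  then have "path [a]"
    by (simp add: path_def)
  moreover have "\<forall>xs. path xs \<longrightarrow> length xs < Suc (card (verts H))"
    using fV by (auto simp: path_def less_Suc_eq_le card_mono distinct_card[symmetric])
  ultimately obtain xs where xs: "path xs" "\<And>ys. path ys \<Longrightarrow> length ys \<le> length xs"
    using ex_has_greatest_nat[of path "[a]" length] by blast
  define x where "x = xs ! 0"
  have len: "0 < length xs" and x: "x \<in> verts H"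
    using xs(1) by (auto simp: path_def x_def)
  have on: "u \<in> set xs" if u: "u \<in> nbrs (edges H) (verts H) x" for u
  proof (rule ccontr)
    assume "u \<notin> set xs"
    then have "path (u # xs)"
      using xs(1) u by (auto simp: path_def nbrs_def x_def nth_Cons split: nat.split)
    then show False
      using xs(2) by fastforce
  qed
  \<comment> \<open>Index 0 would be a loop and index 1 is only one vertex, so the second neighbour
    on the path has index at least 2.\<close>
  have "\<exists>j\<ge>2. j < length xs \<and> xs ! j \<in> nbrs (edges H) (verts H) x"
  proof (rule ccontr)
    assume no: "\<not> ?thesis"
    have "{x} \<notin> edges H"
      using assms(1) by (fastforce simp: fin_graph_def)
    have "nbrs (edges H) (verts H) x \<subseteq> {xs ! 1}"
    proof
      fix u assume u: "u \<in> nbrs (edges H) (verts H) x"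
      then obtain j where j: "j < length xs" "u = xs ! j"
        using on by (metis in_set_conv_nth)
      have "j \<noteq> 0"
        using u j(2) \<open>{x} \<notin> edges H\<close> by (intro notI) (simp add: nbrs_def x_def)
      moreover have "j < 2"
        using no u j by force
      ultimately show "u \<in> {xs ! 1}"
        using j by (simp add: less_2_cases_iff)
    qed
    then have "card (nbrs (edges H) (verts H) x) \<le> card {xs ! 1}"
      by (intro card_mono) auto
    then show False
      using assms(3)[OF x] by simp
  qed
  then obtain j where j: "2 \<le> j" "j < length xs" "{xs ! j, xs ! 0} \<in> edges H"
    by (auto simp: nbrs_def x_def)
  define ys where "ys = take (Suc j) xs"
  have ys: "length ys = Suc j"
    using j by (simp add: ys_def)
  have "{ys ! i, ys ! ((i + 1) mod length ys)} \<in> edges H" if i: "i < length ys" for i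
  proof (cases "i = j")
    case True
    then show ?thesis
      using j ys by (simp add: ys_def)
  next
    case False
    then have "i < j"
      using i ys by simp
    then show ?thesis
      using xs(1) j ys by (simp add: ys_def path_def)
  qed
  moreover have "distinct ys" "set ys \<subseteq> verts H"
    using xs(1) set_take_subset[of "Suc j" xs] by (auto simp: path_def ys_def)
  ultimately show ?thesis
    using that[of ys] j(1) ys by simp
qed

text \<open>Minimum degree 2 provides a cycle \<open>C\<close>. A cycle on \<open>n\<close> vertices
  has density \<open>1 + 1 / (n - 2)\<close>, which decreases in \<open>n\<close>, and
  \<open>m2_dens H\<close> is this expression at \<open>vn H\<close>; a proper subgraph
  \<open>C\<close> would therefore be too dense.\<close>

lemma is_cycle_if_en_eq_vn:
  assumes "fin_graph H" "strictly_2_balanced H" "1 < m2_dens H" "en H = vn H"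
  shows "is_cycle H"
proof -
  note H = strictly_2_balanced_dens[OF assms(1-3)]
  have "verts H \<noteq> {}"
    using H(2) by (auto simp: vn_def)
  then obtain ys where ys: "distinct ys" "set ys \<subseteq> verts H" "3 \<le> length ys"
    "\<And>i. i < length ys \<Longrightarrow> {ys ! i, ys ! ((i + 1) mod length ys)} \<in> edges H"
    using cycle_if_min_degree_2[OF assms(1) _ strictly_2_balanced_degree_ge_2[OF assms(1-3)]] by blast
  define n where "n = length ys"
  define s where "s = (\<lambda>i. (i + 1) mod n)"
  define C where "C = (set ys, (\<lambda>i. {ys ! i, ys ! s i}) ` {..<n})"
  have n: "3 \<le> n"
    using ys(3) by (simp add: n_def)
  have s: "s i < n" "s i = (if i + 1 = n then 0 else i + 1)" if "i < n" for i
    using that by (auto simp: s_def)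
  have nth: "ys ! i = ys ! j \<longleftrightarrow> i = j" if "i < n" "j < n" for i j
    using nth_eq_iff_index_eq[OF ys(1)] that by (simp add: n_def)
  have C: "subgraph C H"
    unfolding subgraph_def fin_graph_def
  proof (intro conjI ballI)
    fix e assume "e \<in> edges C"
    then obtain i where i: "i < n" "e = {ys ! i, ys ! s i}"
      by (auto simp: C_def)
    show "card e = 2"
      using i s[OF i(1)] nth[OF i(1) s(1)[OF i(1)]] n by (auto split: if_splits)
    show "e \<subseteq> verts C"
      using i s(1)[OF i(1)] by (auto simp: C_def n_def)
  qed (use ys in \<open>auto simp: C_def n_def s_def\<close>)
  have inj: "inj_on (\<lambda>i. {ys ! i, ys ! s i}) {..<n}"
  proof (rule inj_onI)
    fix i j assume ij: "i \<in> {..<n}" "j \<in> {..<n}" "{ys ! i, ys ! s i} = {ys ! j, ys ! s j}"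
    then have "i = j \<or> (i = s j \<and> s i = j)"
      using nth s(1) by (auto simp: doubleton_eq_iff)
    then show "i = j"
      using ij s(2)[of i] s(2)[of j] n by (auto split: if_splits)
  qed
  have counts: "vn C = n" "en C = n"
    using ys(1) card_image[OF inj] by (simp_all add: C_def vn_def en_def distinct_card n_def)
  have "C = H"
  proof (rule ccontr)
    assume "C \<noteq> H"
    then have "d2_dens C < m2_dens H"
      using assms(2) C unfolding strictly_2_balanced_def proper_subgraph_def by blast
    moreover have "d2_dens C = (real n - 1) / (real n - 2)"
      using counts n by (simp add: d2_dens_def nonempty_graph_if_en_pos)
    moreover have "m2_dens H = (real (vn H) - 1) / (real (vn H) - 2)"
      using H(2,3) assms(4) by (simp add: field_simps)
    moreover have "n \<le> vn H"
      using card_mono[OF fin_graph_edges(1)[OF assms(1)] ys(2)] counts(1) by (simp add: vn_def C_def)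
    then have "1 + 1 / (real (vn H) - 2) \<le> 1 + 1 / (real n - 2)"
      using n by (intro add_left_mono divide_left_mono) auto
    moreover have "(real n - 1) / (real n - 2) = 1 + 1 / (real n - 2)"
      "(real (vn H) - 1) / (real (vn H) - 2) = 1 + 1 / (real (vn H) - 2)"
      using n H(2) by (simp_all add: field_simps)
    ultimately show False
      by linarith
  qed
  define f where "f = inv_into {..<n} ((!) ys)"
  have inj_nth: "inj_on ((!) ys) {..<n}"
    using nth by (auto simp: inj_on_def)
  have set: "set ys = (!) ys ` {..<n}"
    by (auto simp: n_def set_conv_nth)
  have f: "f (ys ! i) = i" if "i < n" for i
    using inj_nth that by (simp add: f_def)
  have "bij_betw f (verts C) {..<n}"
    unfolding f_def C_def fst_conv set by (rule bij_betw_inv_into) (simp add: bij_betw_def inj_nth)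
  moreover have "edges (cycle_graph n) = (\<lambda>e. f ` e) ` edges C"
  proof -
    have "(\<lambda>e. f ` e) ` edges C = (\<lambda>i. {f (ys ! i), f (ys ! s i)}) ` {..<n}"
      by (auto simp: C_def image_image)
    also have "\<dots> = (\<lambda>i. {i, s i}) ` {..<n}"
      using f s(1) by (intro image_cong) auto
    also have "\<dots> = edges (cycle_graph n)"
      by (auto simp: cycle_graph_def s_def)
    finally show ?thesis ..
  qed
  ultimately have "isomorphic C (cycle_graph n)"
    by (auto simp: isomorphic_def cycle_graph_def)
  then show ?thesis
    using \<open>C = H\<close> n by (auto simp: is_cycle_def)
qed

section \<open>Counts for complete graphs and the case distinction\<close>

lemma vn_ge_2_if_en_pos:
  assumes "fin_graph H" "0 < en H"
  shows "2 \<le> vn H"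
proof (rule ccontr)
  assume "\<not> 2 \<le> vn H"
  then have "vn H = 0 \<or> vn H = 1"
    by auto
  then show False
    using en_le_choose[OF assms(1)] assms(2) by auto
qed

lemma complete_graph_not_colourable:
  assumes "k < a"
  shows "\<not> colourable (complete_graph a) k"
  using vn_le_if_complete_colourable[of "complete_graph a" k] assms
  by (auto simp: complete_graph_def vn_def)

lemma complete_bipartite_graph_counts:
  "vn (complete_bipartite_graph a b) = a + b" "en (complete_bipartite_graph a b) = a * b"
proof -
  show "vn (complete_bipartite_graph a b) = a + b"
    by (simp add: vn_def complete_bipartite_graph_def card_Plus)
  have "edges (complete_bipartite_graph a b) = (\<lambda>(i, j). {Inl i, Inr j}) ` ({..<a} \<times> {..<b})"
    by (auto simp: complete_bipartite_graph_def)
  moreover have "inj_on (\<lambda>(i, j). {Inl i, Inr j}) ({..<a} \<times> {..<b})"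
    by (auto simp: inj_on_def doubleton_eq_iff)
  ultimately show "en (complete_bipartite_graph a b) = a * b"
    by (simp add: en_def card_image card_cartesian_product)
qed

theorem lemma1p9:
  fixes G :: "'a ugraph" and H1 :: "'b ugraph" and H2 :: "'c ugraph"
  assumes "fin_graph G" and "fin_graph H1" and "fin_graph H2"
    and "m2_dens H1 \<ge> m2_dens H2" and "m2_dens H2 > 1"
    and "m_dens G \<le> m2_asym H1 H2"
    and "heart H1 H2"
    and "m2_dens H1 = m2_dens H2
       \<or> chromatic_number H2 \<ge> 3
       \<or> m_dens H2 > 2
       \<or> ar H2 > 2
       \<or> (\<exists>a\<ge>3. isomorphic H1 (complete_graph a))
       \<or> (\<exists>a\<ge>2. \<exists>b\<ge>2. isomorphic H1 (complete_bipartite_graph a b))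
       \<or> (\<exists>l::nat. real l < ar H1 \<and> m2_asym H1 H2 \<le> real l + 1 / 2)
       \<or> (\<exists>l::nat. real l < m_dens H1 \<and> m2_asym H1 H2 \<le> real l + 1 \<and> \<not> is_cycle H2)"
  shows "\<not> arrows G H1 H2"
proof (cases "m2_dens H1 = m2_dens H2")
  case True
  have "strictly_2_balanced H1" "strictly_2_balanced H2"
    using assms(7) True by (simp_all add: heart_def)
  then show ?thesis
    using not_arrows_symmetric_density[OF assms(1-3) _ _ True assms(5)]
      m2_asym_le_if_eq[OF assms(2) True assms(5)] assms(6) True by simp
next
  case False
  define m where "m = m2_asym H1 H2"
  have G: "m_dens G \<le> m"
    using assms(6) by (simp add: m_def)
  have b2: "strictly_2_balanced H2" and gt: "m2_dens H2 < m2_dens H1"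
    using assms(4,7) False by (simp_all add: heart_def)
  note D1 = asymmetric_dens[OF assms(2,3,7,5) gt, folded m_def]
  note D2 = strictly_2_balanced_dens[OF assms(3) b2 assms(5)]
  have m1: "1 < m"
    using D1(1) assms(5) by simp
  have ne: "verts H1 \<noteq> {}" "verts H2 \<noteq> {}"
    using D1(2) D2(2) by (auto simp: vn_def)
  note sparse = not_arrows_two_sparse[OF assms(1), where ?H1.0 = H1 and ?H2.0 = H2]
  have sub1: "subgraph H1 H1" "2 \<le> vn H1" and sub2: "subgraph H2 H2" "2 \<le> vn H2"
    using assms(2,3) D1(2) D2(2) by (auto simp: subgraph_refl)
  have pseudo: "int (card (induced_edges (edges G) S)) \<le> k * int (card S)"
    if "m \<le> real_of_int k" "S \<subseteq> verts G" for k S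
    using card_induced_edges_le_pseudoforests[OF assms(1) G that] .
  have forests: "int (card (induced_edges (edges G) S)) \<le> k * int (card S) - k"
    if "m + 1 / 2 \<le> real_of_int k" "S \<subseteq> verts G" "2 \<le> card S" for k S
    using card_induced_edges_le_forests[OF assms(1) G that] .
  consider (chromatic) "chromatic_number H2 \<ge> 3" | (density) "m_dens H2 > 2" | (arboricity) "ar H2 > 2"
    | (complete) a where "a \<ge> 3" "isomorphic H1 (complete_graph a)"
    | (bipartite) a b where "a \<ge> 2" "b \<ge> 2" "isomorphic H1 (complete_bipartite_graph a b)"
    | (half) l :: nat where "real l < ar H1" "m \<le> real l + 1 / 2"
    | (one) l :: nat where "real l < m_dens H1" "m \<le> real l + 1" "\<not> is_cycle H2"
    using assms(8) False unfolding m_def by metis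
  then show ?thesis
  proof cases
    case chromatic
    define d where "d = nat \<lfloor>m\<rfloor> + 1"
    have d: "m < real d" "\<And>k. m < real k \<Longrightarrow> d \<le> k"
      using m1 unfolding d_def by linarith+
    have "chromatic_number H2 \<le> 2" if "colourable H2 2"
      unfolding chromatic_number_def using that by (rule Least_le)
    then have "\<not> colourable H2 2"
      using chromatic by linarith
    then show ?thesis
      using not_arrows_vertex_partition(1)[OF assms(1) G, of 2 d H1 H2] d D1(6) ne(1) by simp
  next
    case density
    obtain J where J: "subgraph J H2" "d_dens J = m_dens H2"
      using Max_dens_witness[OF assms(3), of d_dens] unfolding m_dens_def .
    then have "2 < d_dens J"
      using density by simp
    then have "2 * real (vn J) < real (en J)"
      by (auto simp: d_dens_def pos_less_divide_eq split: if_splits)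
    then have eJ: "2 * vn J < en J"
      by linarith
    \<comment> \<open>Two of the \<open>k\<close> pseudoforests covering \<open>G\<close> cannot
      hold \<open>H2\<close>. The other \<open>k - 2 < m - 1\<close> cannot hold \<open>H1\<close>,
      because \<open>e(H1) > m * v(H1) - 2 * m + 1\<close> and
      \<open>v(H1) > 2 * m - 1\<close>.\<close>
    define k where "k = \<lceil>m\<rceil>"
    have k: "m \<le> real_of_int k" "real_of_int k < m + 1" "2 \<le> k"
      using m1 unfolding k_def by linarith+
    have "(real_of_int k - 2) * real (vn H1) \<le> (m - 1) * real (vn H1)"
      using k by (intro mult_right_mono) auto
    also have "\<dots> < real (en H1)"
      using D1(4,5) by (simp add: algebra_simps)
    finally have "real_of_int ((k - 2) * int (vn H1)) < real_of_int (int (en H1))"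
      by simp
    then have "(k - 2) * int (vn H1) < int (en H1)"
      by (simp only: of_int_less_iff)
    moreover have "2 \<le> vn J"
      using vn_ge_2_if_en_pos[of J] eJ J(1) by (simp add: subgraph_def)
    ultimately show ?thesis
      using pseudo[OF k(1)] k(3) eJ J(1) sub1
      by (intro sparse[of 0 "k - 2" 0 2 H1 J]) auto
  next
    case arboricity
    obtain J where J: "subgraph J H2" "d1_dens J = ar H2"
      using Max_dens_witness[OF assms(3), of d1_dens] unfolding ar_def .
    then have "2 < d1_dens J"
      using arboricity by simp
    then have vJ: "2 \<le> vn J" and "2 * (real (vn J) - 1) < real (en J)"
      by (auto simp: d1_dens_def pos_less_divide_eq split: if_splits)
    then have "real_of_int (2 * int (vn J) - 2) < real_of_int (int (en J))"
      by simp
    then have eJ: "2 * int (vn J) - 2 < int (en J)"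
      by (simp only: of_int_less_iff)
    \<comment> \<open>The same with forests: now \<open>k - 2 < m - 1 / 2\<close>, and
      \<open>(m - 1 / 2) * (v(H1) - 1) < e(H1)\<close> again comes from
      \<open>2 * m < v(H1) + 1\<close>.\<close>
    define k where "k = \<lceil>m + 1 / 2\<rceil>"
    have k: "m + 1 / 2 \<le> real_of_int k" "real_of_int k < m + 1 / 2 + 1" "2 \<le> k"
      using m1 unfolding k_def by linarith+
    have "(real_of_int k - 2) * (real (vn H1) - 1) \<le> (m - 1 / 2) * (real (vn H1) - 1)"
      using k D1(2) by (intro mult_right_mono) auto
    also have "\<dots> < real (en H1)"
      using D1(4,5) by (simp add: field_simps)
    finally have "real_of_int ((k - 2) * int (vn H1) - (k - 2)) < real_of_int (int (en H1))"
      by (simp add: algebra_simps)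
    then have "(k - 2) * int (vn H1) - (k - 2) < int (en H1)"
      by (simp only: of_int_less_iff)
    then show ?thesis
      using forests[OF k(1)] k(3) eJ vJ J(1) sub1
      by (intro sparse[of "k - 2" "k - 2" 2 2 H1 J]) auto
  next
    case (complete a)
    have "vn H1 = a"
      using isomorphic_card_eq(1)[OF complete(2) assms(2)] by (simp add: vn_def complete_graph_def)
    \<comment> \<open>From \<open>2 * m < a + 1\<close> and \<open>a \<ge> 3\<close>, so
      \<open>a - 1\<close> classes work with \<open>d = 2\<close>. The clique is excluded between
      the classes, and \<open>H2\<close>, of minimum degree at least 2, inside them.\<close>
    then have "2 * m < real ((a - 1) * 2)"
      using D1(5) complete(1) by (simp add: of_nat_diff)
    moreover have "\<not> colourable H1 (a - 1)"
      using complete_graph_not_colourable[of "a - 1" a] colourable_isomorphic[OF complete(2) assms(2)]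
        complete(1) by auto
    ultimately show ?thesis
      using not_arrows_vertex_partition(2)[OF assms(1) G _ ne(2)
          strictly_2_balanced_degree_ge_2[OF assms(3) b2 assms(5)]] by blast
  next
    case (bipartite a b)
    have H1: "vn H1 = a + b" "en H1 = a * b"
      using isomorphic_card_eq[OF bipartite(3) assms(2)] by (simp_all add: complete_bipartite_graph_counts)
    have "0 \<le> (int a - int b)\<^sup>2"
      by simp
    then have "int (4 * en H1) \<le> int ((vn H1)\<^sup>2)"
      by (simp add: H1 power2_eq_square algebra_simps)
    then have "4 * en H1 \<le> (vn H1)\<^sup>2"
      by (simp only: of_nat_le_iff)
    moreover have "real_of_int \<lfloor>m\<rfloor> * (real (vn H1) - 2) \<le> m * (real (vn H1) - 2)"
      using D1(2) by (intro mult_right_mono) auto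
    then have "real_of_int \<lfloor>m\<rfloor> * (real (vn H1) - 2) < real (en H1) - 1"
      using D1(4) by (rule le_less_trans)
    ultimately show ?thesis
      using not_arrows_forest_plus_sparse(1)[OF assms(1) G _ assms(2,3)] m1 bipartite(1,2) H1(1) D1(4) D2(2,4)
      by simp
  next
    case (half l)
    obtain J where J: "subgraph J H1" "d1_dens J = ar H1"
      using Max_dens_witness[OF assms(2), of d1_dens] unfolding ar_def .
    then have "real l < d1_dens J"
      using half(1) by simp
    then have vJ: "2 \<le> vn J" and "real l * (real (vn J) - 1) < real (en J)"
      by (auto simp: d1_dens_def pos_less_divide_eq split: if_splits)
    then have "real_of_int (int l * int (vn J) - int l) < real_of_int (int (en J))"
      by (simp add: algebra_simps)
    then have eJ: "int l * int (vn J) - int l < int (en J)"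
      by (simp only: of_int_less_iff)
    \<comment> \<open>Of \<open>l + 1\<close> forests, \<open>l\<close> are too few for
      \<open>J\<close>, and one cannot hold \<open>H2\<close>, which has a cycle as
      \<open>vn H2 \<le> en H2\<close>.\<close>
    have "m + 1 / 2 \<le> real_of_int (int l + 1)"
      using half(2) by simp
    then show ?thesis
      using forests[of "int l + 1"] eJ vJ J(1) sub2 D2(4)
      by (intro sparse[of "int l" "int l" 1 1 J H2]) (auto simp: algebra_simps)
  next
    case (one l)
    obtain J where J: "subgraph J H1" "d_dens J = m_dens H1"
      using Max_dens_witness[OF assms(2), of d_dens] unfolding m_dens_def .
    then have "real l < d_dens J"
      using one(1) by simp
    then have "real l * real (vn J) < real (en J)"
      by (auto simp: d_dens_def pos_less_divide_eq split: if_splits)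
    then have eJ: "l * vn J < en J"
      by (metis of_nat_less_iff of_nat_mult)
    then have vJ: "2 \<le> vn J"
      using vn_ge_2_if_en_pos[of J] J(1) by (simp add: subgraph_def)
    \<comment> \<open>\<open>H2\<close> must not fit into one pseudoforest, so
      \<open>en H2 = vn H2\<close> has to be ruled out; a strictly 2-balanced graph of density above
      1 attains it only as a cycle.\<close>
    have "vn H2 < en H2"
      using is_cycle_if_en_eq_vn[OF assms(3) b2 assms(5)] one(3) D2(4) by force
    moreover have "int l * int (vn J) < int (en J)"
      using eJ by (metis of_nat_less_iff of_nat_mult)
    moreover have "m \<le> real_of_int (int l + 1)"
      using one(2) by simp
    ultimately show ?thesis
      using pseudo[of "int l + 1"] vJ J(1) sub2
      by (intro sparse[of 0 "int l" 0 1 J H2]) auto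
  qed
qed

end
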